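(* For every $\varepsilon>0$, there exist constants $c=c(\varepsilon)>0$ and $c'=c'(\varepsilon)>0$ with $c<c'$ such that for all $n,r\in\mathbb{N}$ with $r\le (1/2-\varepsilon)n$, \[ \mathbb{P}\left(\alpha(K_p(n,r))=\binom{n-1}{r-1}\right)\to \begin{cases} 1 & \text{if } p\ge \binom{n-1}{r-1}^{-c},\\ 0 & \text{if } p\le \binom{n-1}{r-1}^{-c'}, \end{cases} \] as $n\to\infty$. In particular, with high probability, $\alpha(K_{1/2}(n,r))=\binom{n-1}{r-1}$.
   Context: For natural numbers $n\ge r$, the Kneser graph $K(n,r)$ is the graph whose vertices are the $r$-element subsets of $[n]=\{1,\dots,n\}$, two vertices being adjacent if and only if they are disjoint sets. $K_p(n,r)$ is the random subgraph of $K(n,r)$ on the same vertex set obtained by retaining each edge of $K(n,r)$ independently with probability $p$. For a graph $G$, $\alpha(G)$ denotes the size of a largest independent set of $G$. Here $r=r(n)$ and $p=p(n)$ may depend on $n$, and "with high probability" means with probability tending to $1$ as $n\to\infty$.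
   Formalization: The 0-statement and the p=1/2 statement are proved for r≥2 only: for r=1 both thresholds equal 1, so p=1 gives probability 1 (not 0), and at p=1/2 the probability that α=1 tends to 0. *)

theory Defs
  imports "HOL-Probability.Probability" "HOL-Library.Ramsey"
begin

(* A simple graph is given by its vertex set V and its set E of two-element edges. *)

definition independence_number :: "'a set \<Rightarrow> 'a set set \<Rightarrow> nat" where
  "independence_number V E = Max (card ` {S. S \<subseteq> V \<and> indep S E})"

definition kneser_verts :: "nat \<Rightarrow> nat \<Rightarrow> nat set set" where
  "kneser_verts n r = nsets {1..n} r"

(* The condition A \<noteq> B only matters for r = 0, where it excludes a loop at the empty set. *)
definition kneser_edges :: "nat \<Rightarrow> nat \<Rightarrow> nat set set set" where
  "kneser_edges n r =
     {{A, B} | A B. A \<in> kneser_verts n r \<and> B \<in> kneser_verts n r \<and> A \<noteq> B \<and> A \<inter> B = {}}"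

(* Each e in E is kept when its own
   independent Bernoulli(p) coin f e shows True. Intended for finite E and p in [0, 1]. *)
definition random_edges :: "'a set set \<Rightarrow> real \<Rightarrow> 'a set set pmf" where
  "random_edges E p =
     map_pmf (\<lambda>f. {e \<in> E. f e}) (Pi_pmf E False (\<lambda>_. bernoulli_pmf p))"

definition random_kneser_edges :: "real \<Rightarrow> nat \<Rightarrow> nat \<Rightarrow> nat set set set pmf" where
  "random_kneser_edges p n r = random_edges (kneser_edges n r) p"

definition prob_EKR :: "real \<Rightarrow> nat \<Rightarrow> nat \<Rightarrow> real" where
  "prob_EKR p n r =
     measure_pmf.prob (random_kneser_edges p n r)
       {E. independence_number (kneser_verts n r) E = (n - 1) choose (r - 1)}"

end

theory Submission
  imports Defs "HOL-Real_Asymp.Real_Asymp"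
begin

text \<open>Write V = n choose r, N = (n - 1) choose (r - 1) and D = (n - r) choose r. If p is small, a star plus one
  further vertex spans at most N edges, and with high probability none of them is kept.

  If p is large, one shows that every family F of N + 1 vertices has a star S such that F spans at
  least K |F \<triangle> S| edges, where p K >= 4 ln V. As (1 - p) to the number of edges is then at
  most q ^ |F \<triangle> S| with q = exp (- p K) <= V ^ -4, a union bound over the symmetric differences gives a
  failure probability of at most n ((1 + q) ^ V - 1) <= 2 / n.

  For bounded r this supersaturation follows from the degrees of F. For large r it comes from Katona's
  cycle method: place the elements on a circle by a random permutation. If F spans few edges, almost no
  permutation shows two disjoint arcs from F, so for almost all of them the arcs in F are exactly
  the r arcs through one position m. Swapping two adjacent elements away from m cannot move m unless it leads to
  one of the few exceptional permutations; hence for some m and x almost all permutations with x at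
  position m are of this kind, and F is close to the star at x. This costs only a factor polynomial in n,
  while D is at least a fixed power of V because r <= (1/2 - \<epsilon>) n.\<close>

text \<open>If every family were charged its worst case, the union bound would fail: a star plus one
  vertex spans at most N edges, while the families of N + 1 vertices are exponentially many in N.
  Only those close to a star are that sparse, and at distance k from a given star there are at most
  (V choose k) of them, which q ^ k with V q small outweighs. This is why supersaturation is
  measured by the distance to a star.

  The two regimes of r come from the losses. The circle argument loses a factor n^7, and 4 ln V can
  cost another n; for bounded r, D is at most n^r, so this may be more than there is to lose. The
  degree argument loses only a factor of order r but requires 4 r^3 < n. Conversely, for r >= R one
  has V >= (n/R)^R, and a large constant R makes any fixed power of V beat n^8.

  For r = 1 one has N = 1, so the upper range means p = 1 and there is no room for a logarithm; this
  case is deterministic.\<close>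

section \<open>Counting with a uniformly random permutation\<close>

text \<open>Each fibre injects into every other one, so all have the same size; having injections in
  both directions replaces exhibiting bijections. In the uses below, g is composition on the left
  with a permutation that moves one image to another. Uniformity is stated as an identity of
  products to stay within the naturals.\<close>

lemma fiber_uniform:
  fixes \<phi> :: "'a \<Rightarrow> 'b"
  assumes fin: "finite \<Omega>" "finite Y" and im: "\<phi> ` \<Omega> \<subseteq> Y" and G: "G \<subseteq> Y"
    and tr: "\<And>y y'. y \<in> Y \<Longrightarrow> y' \<in> Y \<Longrightarrow>
       \<exists>g. inj_on g \<Omega> \<and> (\<forall>\<pi>\<in>\<Omega>. \<phi> \<pi> = y \<longrightarrow> g \<pi> \<in> \<Omega> \<and> \<phi> (g \<pi>) = y')"
  shows "card Y * card {\<pi>\<in>\<Omega>. \<phi> \<pi> \<in> G} = card G * card \<Omega>"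
proof -
  define f where "f y = card {\<pi>\<in>\<Omega>. \<phi> \<pi> = y}" for y
  have le: "f y \<le> f y'" if "y \<in> Y" "y' \<in> Y" for y y'
  proof -
    obtain g where g: "inj_on g \<Omega>" "\<forall>\<pi>\<in>\<Omega>. \<phi> \<pi> = y \<longrightarrow> g \<pi> \<in> \<Omega> \<and> \<phi> (g \<pi>) = y'"
      using tr[OF \<open>y \<in> Y\<close> \<open>y' \<in> Y\<close>] by blast
    show ?thesis unfolding f_def
      using g fin by (intro card_inj_on_le[where f=g]) (auto intro: inj_on_subset)
  qed
  have cnt: "card {\<pi>\<in>\<Omega>. \<phi> \<pi> \<in> H} = (\<Sum>y\<in>H. f y)" if "H \<subseteq> Y" for H
  proof -
    have "{\<pi>\<in>\<Omega>. \<phi> \<pi> \<in> H} = (\<Union>y\<in>H. {\<pi>\<in>\<Omega>. \<phi> \<pi> = y})" by auto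
    moreover have "finite H" using that fin finite_subset by blast
    ultimately show ?thesis
      unfolding f_def using fin by (simp, subst card_UN_disjoint) auto
  qed
  show ?thesis
  proof (cases "Y = {}")
    case True then show ?thesis using im G by auto
  next
    case False
    then obtain y0 where y0: "y0 \<in> Y" by auto
    have const: "f y = f y0" if "y \<in> Y" for y using le that y0 by (meson le_antisym)
    have "card {\<pi>\<in>\<Omega>. \<phi> \<pi> \<in> G} = card G * f y0"
      using cnt[OF G] const G by (simp add: subset_iff)
    moreover have "card {\<pi>\<in>\<Omega>. \<phi> \<pi> \<in> Y} = card Y * f y0"
      using cnt[of Y] const by simp
    moreover have "{\<pi>\<in>\<Omega>. \<phi> \<pi> \<in> Y} = \<Omega>" using im by auto
    ultimately show ?thesis by (simp add: ac_simps)
  qed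
qed

lemma permutes_extending_bij_betw:
  assumes "finite S" "A \<subseteq> S" "B \<subseteq> S" "bij_betw g A B"
  obtains \<sigma> where "\<sigma> permutes S" "\<And>a. a \<in> A \<Longrightarrow> \<sigma> a = g a"
proof -
  have "card (S - A) = card (S - B)"
    using assms by (simp add: card_Diff_subset finite_subset bij_betw_same_card)
  then obtain h where h: "bij_betw h (S - A) (S - B)"
    using assms(1) finite_same_card_bij[of "S - A" "S - B"] by auto
  define \<sigma> where "\<sigma> x = (if x \<in> A then g x else if x \<in> S then h x else x)" for x
  have "bij_betw \<sigma> A B" using assms(4) by (rule bij_betw_cong[THEN iffD1, rotated]) (simp add: \<sigma>_def)
  moreover have "bij_betw \<sigma> (S - A) (S - B)"
    using h by (rule bij_betw_cong[THEN iffD1, rotated]) (simp add: \<sigma>_def)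
  ultimately have "bij_betw \<sigma> (A \<union> (S - A)) (B \<union> (S - B))"
    by (rule bij_betw_combine) auto
  then have "bij_betw \<sigma> S S" using assms by (simp add: Un_absorb1)
  then have "\<sigma> permutes S" by (rule bij_imp_permutes) (use assms in \<open>auto simp: \<sigma>_def\<close>)
  then show ?thesis using that by (auto simp: \<sigma>_def)
qed

lemma inj_on_comp_permutes: "\<sigma> permutes S \<Longrightarrow> inj_on (\<lambda>\<pi>. \<sigma> \<circ> \<pi>) X"
  by (rule inj_onI) (metis fun.inj_map inj_def permutes_inj)

lemma card_permutations_image_in:
  assumes S: "finite S" and A: "A \<in> nsets S r" and F: "F \<subseteq> nsets S r"
  shows "(card S choose r) * card {\<pi>. \<pi> permutes S \<and> \<pi> ` A \<in> F} = card F * fact (card S)"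
proof -
  have "card (nsets S r) * card {\<pi>\<in>{\<pi>. \<pi> permutes S}. \<pi> ` A \<in> F} = card F * card {\<pi>. \<pi> permutes S}"
  proof (rule fiber_uniform)
    show "(\<lambda>\<pi>. \<pi> ` A) ` {\<pi>. \<pi> permutes S} \<subseteq> nsets S r"
      using A by (auto simp: nsets_def permutes_in_image subset_iff card_image permutes_inj_on)
    show "\<exists>g. inj_on g {\<pi>. \<pi> permutes S} \<and>
         (\<forall>\<pi>\<in>{\<pi>. \<pi> permutes S}. \<pi> ` A = y \<longrightarrow> g \<pi> \<in> {\<pi>. \<pi> permutes S} \<and> g \<pi> ` A = y')"
      if y: "y \<in> nsets S r" "y' \<in> nsets S r" for y y'
    proof -
      obtain b where b: "bij_betw b y y'"
        using y finite_same_card_bij[of y y'] by (auto simp: nsets_def)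
      obtain \<sigma> where \<sigma>: "\<sigma> permutes S" "\<And>a. a \<in> y \<Longrightarrow> \<sigma> a = b a"
        using permutes_extending_bij_betw[OF S _ _ b] y by (auto simp: nsets_def)
      have "\<sigma> ` y = y'" using \<sigma> b by (simp add: bij_betw_def)
      then show ?thesis using \<sigma>(1)
        by (intro exI[of _ "\<lambda>\<pi>. \<sigma> \<circ> \<pi>"])
           (auto simp: inj_on_comp_permutes permutes_compose simp flip: image_image)
    qed
  qed (use S F in \<open>auto simp: finite_permutations finite_imp_finite_nsets\<close>)
  then show ?thesis using S by (simp add: card_permutations)
qed

text \<open>Ordered pairs, so that the images of two fixed disjoint sets range over a single orbit
  of the symmetric group. The price is a factor 2 against edges.\<close>

definition disjoint_pairs :: "'a set \<Rightarrow> nat \<Rightarrow> ('a set \<times> 'a set) set" where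
  "disjoint_pairs S r = {(A, B). A \<in> nsets S r \<and> B \<in> nsets S r \<and> A \<inter> B = {}}"

lemma finite_disjoint_pairs: "finite S \<Longrightarrow> finite (disjoint_pairs S r)"
  by (rule finite_subset[of _ "nsets S r \<times> nsets S r"])
     (auto simp: disjoint_pairs_def finite_imp_finite_nsets)

lemma card_disjoint_pairs:
  assumes "finite S"
  shows "card (disjoint_pairs S r) = (card S choose r) * ((card S - r) choose r)"
proof -
  have "disjoint_pairs S r = (SIGMA A:nsets S r. nsets (S - A) r)"
    by (auto simp: disjoint_pairs_def nsets_def)
  moreover have "card (nsets (S - A) r) = (card S - r) choose r" if "A \<in> nsets S r" for A
    using that assms by (simp add: card_nsets) (auto simp: nsets_def card_Diff_subset)
  ultimately show ?thesis using assms by (simp add: card_SigmaI finite_imp_finite_nsets)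
qed

text \<open>Bijections from B to C and from B' to C' glue to one between the unions, since both
  pairs are disjoint, and this one extends to a permutation of S. Hence all ordered disjoint pairs
  are equally likely as images.\<close>

lemma card_permutations_pair_in:
  assumes S: "finite S" and A: "(A, A') \<in> disjoint_pairs S r" and P: "P \<subseteq> disjoint_pairs S r"
  shows "(card S choose r) * ((card S - r) choose r) *
      card {\<pi>. \<pi> permutes S \<and> (\<pi> ` A, \<pi> ` A') \<in> P} = card P * fact (card S)"
proof -
  have "card (disjoint_pairs S r) * card {\<pi>\<in>{\<pi>. \<pi> permutes S}. (\<pi> ` A, \<pi> ` A') \<in> P}
     = card P * card {\<pi>. \<pi> permutes S}"
  proof (rule fiber_uniform)
    show "(\<lambda>\<pi>. (\<pi> ` A, \<pi> ` A')) ` {\<pi>. \<pi> permutes S} \<subseteq> disjoint_pairs S r"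
    proof (clarify)
      fix \<pi> assume \<pi>: "\<pi> permutes S"
      have "\<pi> ` A \<inter> \<pi> ` A' = \<pi> ` (A \<inter> A')" using permutes_inj[OF \<pi>] by (simp add: image_Int)
      then show "(\<pi> ` A, \<pi> ` A') \<in> disjoint_pairs S r"
        using A \<pi> by (auto simp: disjoint_pairs_def nsets_def permutes_in_image subset_iff card_image permutes_inj_on)
    qed
    show "\<exists>g. inj_on g {\<pi>. \<pi> permutes S} \<and>
         (\<forall>\<pi>\<in>{\<pi>. \<pi> permutes S}. (\<pi> ` A, \<pi> ` A') = y \<longrightarrow>
             g \<pi> \<in> {\<pi>. \<pi> permutes S} \<and> (g \<pi> ` A, g \<pi> ` A') = y')"
      if y: "y \<in> disjoint_pairs S r" "y' \<in> disjoint_pairs S r" for y y'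
    proof -
      obtain B B' C C' where e: "y = (B, B')" "y' = (C, C')" by (cases y; cases y') auto
      have q: "B \<in> nsets S r" "B' \<in> nsets S r" "B \<inter> B' = {}" "C \<in> nsets S r" "C' \<in> nsets S r" "C \<inter> C' = {}"
        using y by (auto simp: e disjoint_pairs_def)
      obtain b where b: "bij_betw b B C"
        using q finite_same_card_bij[of B C] by (auto simp: nsets_def)
      obtain b' where b': "bij_betw b' B' C'"
        using q finite_same_card_bij[of B' C'] by (auto simp: nsets_def)
      define h where "h x = (if x \<in> B then b x else b' x)" for x
      have hB: "bij_betw h B C" using b by (rule bij_betw_cong[THEN iffD1, rotated]) (simp add: h_def)
      have hB': "bij_betw h B' C'"
        using b' by (rule bij_betw_cong[THEN iffD1, rotated]) (use q in \<open>auto simp: h_def\<close>)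
      have h: "bij_betw h (B \<union> B') (C \<union> C')" using bij_betw_combine[OF hB hB'] q by simp
      obtain \<sigma> where \<sigma>: "\<sigma> permutes S" "\<And>a. a \<in> B \<union> B' \<Longrightarrow> \<sigma> a = h a"
        using permutes_extending_bij_betw[OF S _ _ h] q by (auto simp: nsets_def)
      have "\<sigma> ` B = C" "\<sigma> ` B' = C'" using \<sigma> hB hB' by (auto simp: bij_betw_def)
      then show ?thesis using \<sigma>(1)
        by (intro exI[of _ "\<lambda>\<pi>. \<sigma> \<circ> \<pi>"])
           (auto simp: e inj_on_comp_permutes permutes_compose simp flip: image_image)
    qed
  qed (use S P in \<open>auto simp: finite_permutations finite_disjoint_pairs\<close>)
  then show ?thesis using S by (simp add: card_permutations card_disjoint_pairs)
qed

lemma card_permutations_point: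
  assumes S: "finite S" and m: "m \<in> S" "x \<in> S"
  shows "card {\<pi>. \<pi> permutes S \<and> \<pi> m = x} = fact (card S - 1)"
proof -
  have "card S * card {\<pi>\<in>{\<pi>. \<pi> permutes S}. \<pi> m \<in> {x}} = card {x} * card {\<pi>. \<pi> permutes S}"
  proof (rule fiber_uniform)
    show "\<exists>g. inj_on g {\<pi>. \<pi> permutes S} \<and>
         (\<forall>\<pi>\<in>{\<pi>. \<pi> permutes S}. \<pi> m = y \<longrightarrow> g \<pi> \<in> {\<pi>. \<pi> permutes S} \<and> g \<pi> m = y')"
      if y: "y \<in> S" "y' \<in> S" for y y'
      using permutes_swap_id[OF y]
      by (intro exI[of _ "\<lambda>\<pi>. Transposition.transpose y y' \<circ> \<pi>"])
         (auto simp: inj_on_comp_permutes permutes_compose)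
  qed (use S m in \<open>auto simp: finite_permutations permutes_in_image\<close>)
  then have "card S * card {\<pi>. \<pi> permutes S \<and> \<pi> m = x} = fact (card S)"
    using S by (simp add: card_permutations)
  moreover have "card S > 0" using S m by (auto simp: card_gt_0_iff)
  ultimately have "card S * card {\<pi>. \<pi> permutes S \<and> \<pi> m = x} = card S * fact (card S - 1)"
    by (simp add: fact_reduce)
  then show ?thesis using \<open>card S > 0\<close> by simp
qed

lemma card_nsets_containing:
  assumes "finite S" "x \<in> S" "r \<ge> 1"
  shows "card {B \<in> nsets S r. x \<in> B} = (card S - 1) choose (r - 1)"
proof -
  have "bij_betw (\<lambda>B. insert x B) (nsets (S - {x}) (r - 1)) {B \<in> nsets S r. x \<in> B}"
  proof (rule bij_betw_byWitness[where f'="\<lambda>B. B - {x}"])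
    show "insert x ` nsets (S - {x}) (r - 1) \<subseteq> {B \<in> nsets S r. x \<in> B}"
      using assms by (auto simp: nsets_def subset_iff card_insert_if)
    show "(\<lambda>B. B - {x}) ` {B \<in> nsets S r. x \<in> B} \<subseteq> nsets (S - {x}) (r - 1)"
      using assms by (auto simp: nsets_def)
  qed (auto simp: nsets_def)
  then have "card {B \<in> nsets S r. x \<in> B} = card (nsets (S - {x}) (r - 1))"
    by (metis bij_betw_same_card)
  then show ?thesis using assms by simp
qed

text \<open>A bijection between two members of the star at x can be chosen to fix x, so conditioning
  on \<pi> m = x leaves the image of A uniform on that star.\<close>

lemma card_permutations_point_image_in:
  assumes S: "finite S" and m: "m \<in> A" "x \<in> S" and A: "A \<in> nsets S r" "r \<ge> 1"
    and G: "G \<subseteq> {B \<in> nsets S r. x \<in> B}"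
  shows "((card S - 1) choose (r - 1)) * card {\<pi>. \<pi> permutes S \<and> \<pi> m = x \<and> \<pi> ` A \<in> G}
    = card G * fact (card S - 1)"
proof -
  let ?\<Omega> = "{\<pi>. \<pi> permutes S \<and> \<pi> m = x}"
  have "card {B \<in> nsets S r. x \<in> B} * card {\<pi>\<in>?\<Omega>. \<pi> ` A \<in> G} = card G * card ?\<Omega>"
  proof (rule fiber_uniform)
    show "(\<lambda>\<pi>. \<pi> ` A) ` ?\<Omega> \<subseteq> {B \<in> nsets S r. x \<in> B}"
      using A m by (auto simp: nsets_def permutes_in_image subset_iff card_image permutes_inj_on)
    show "\<exists>g. inj_on g ?\<Omega> \<and> (\<forall>\<pi>\<in>?\<Omega>. \<pi> ` A = y \<longrightarrow> g \<pi> \<in> ?\<Omega> \<and> g \<pi> ` A = y')"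
      if "y \<in> {B \<in> nsets S r. x \<in> B}" "y' \<in> {B \<in> nsets S r. x \<in> B}" for y y'
    proof -
      have y: "finite y" "finite y'" "card y = r" "card y' = r" "y \<subseteq> S" "y' \<subseteq> S" "x \<in> y" "x \<in> y'"
        using that by (auto simp: nsets_def)
      have "card (y - {x}) = card (y' - {x})" using y by simp
      then obtain b where b: "bij_betw b (y - {x}) (y' - {x})"
        using y finite_same_card_bij[of "y - {x}" "y' - {x}"] by auto
      have "bij_betw (b(x := x)) (y - {x}) (y' - {x})"
        using b by (rule bij_betw_cong[THEN iffD1, rotated]) simp
      moreover have "bij_betw (b(x := x)) {x} {x}" by (simp add: bij_betw_def)
      ultimately have "bij_betw (b(x := x)) ((y - {x}) \<union> {x}) ((y' - {x}) \<union> {x})"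
        by (rule bij_betw_combine) auto
      then have b: "bij_betw (b(x := x)) y y'" using y by (simp add: insert_absorb)
      obtain \<sigma> where \<sigma>: "\<sigma> permutes S" "\<And>a. a \<in> y \<Longrightarrow> \<sigma> a = (b(x := x)) a"
        using permutes_extending_bij_betw[OF S \<open>y \<subseteq> S\<close> \<open>y' \<subseteq> S\<close> b] by blast
      have "\<sigma> ` y = y'" using \<sigma> b by (metis bij_betw_def image_cong)
      moreover have "\<sigma> x = x" using \<sigma> y by simp
      ultimately show ?thesis using \<sigma>(1)
        by (intro exI[of _ "\<lambda>\<pi>. \<sigma> \<circ> \<pi>"])
           (auto simp: inj_on_comp_permutes permutes_compose simp flip: image_image)
    qed
  qed (use S G in \<open>auto simp: finite_permutations finite_imp_finite_nsets\<close>)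
  moreover have "m \<in> S" using A m by (auto simp: nsets_def)
  ultimately show ?thesis
    using S A m by (simp add: card_nsets_containing card_permutations_point conj_assoc)
qed

section \<open>Arcs on the circle and Katona's lemma\<close>

text \<open>The representative of z modulo n in {1..n}; shifting by 1 before and after reduction
  makes n, not 0, represent the multiples of n. Integer arguments allow steps backwards past
  position 1.\<close>

definition wrap :: "nat \<Rightarrow> int \<Rightarrow> nat" where
  "wrap n z = nat ((z - 1) mod int n) + 1"

lemma wrap_in: "n > 0 \<Longrightarrow> wrap n z \<in> {1..n}"
  by (simp add: wrap_def Suc_le_eq nat_less_iff)

lemma int_wrap: "n > 0 \<Longrightarrow> int (wrap n z) = (z - 1) mod int n + 1"
  by (simp add: wrap_def)

lemma wrap_mod: "n > 0 \<Longrightarrow> (int (wrap n z) + a) mod int n = (z + a) mod int n"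
proof -
  assume "n > 0"
  then have "(int (wrap n z) + a) mod int n = ((z - 1) mod int n + (1 + a)) mod int n"
    by (simp add: int_wrap add.assoc)
  also have "\<dots> = (z - 1 + (1 + a)) mod int n" by (rule mod_add_left_eq)
  finally show ?thesis by simp
qed

lemma wrap_mod_diff: "n > 0 \<Longrightarrow> (a - int (wrap n z)) mod int n = (a - z) mod int n"
proof -
  assume n: "n > 0"
  have "int (wrap n z) mod int n = z mod int n" using wrap_mod[OF n, of z 0] by simp
  then show ?thesis by (metis mod_diff_right_eq)
qed

lemma eq_of_mod_eq:
  assumes "i \<in> {1..n}" "j \<in> {1..n}" "(int i - z) mod int n = (int j - z) mod int n"
  shows "i = j"
proof -
  have "int n dvd int i - int j" using assms(3) by (simp add: mod_eq_dvd_iff)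
  then have "\<bar>int i - int j\<bar> < int n \<Longrightarrow> int i - int j = 0"
    using zdvd_imp_le[of "int n" "\<bar>int i - int j\<bar>"] by (cases "int i - int j = 0") auto
  then show ?thesis using assms(1,2) by auto
qed

lemma eq_of_mod_eq':
  assumes "i \<in> {1..n}" "j \<in> {1..n}" "(z - int i) mod int n = (z - int j) mod int n"
  shows "i = j"
proof -
  have "int n dvd (z - int i) - (z - int j)" using assms(3) by (simp add: mod_eq_dvd_iff)
  then have "int n dvd (int j - z) - (int i - z)" by simp
  then have "(int j - z) mod int n = (int i - z) mod int n" by (simp only: mod_eq_dvd_iff)
  then show ?thesis using eq_of_mod_eq[OF assms(1,2), of z] by simp
qed

lemma wrap_eq: "i \<in> {1..n} \<Longrightarrow> (z - int i) mod int n = 0 \<Longrightarrow> wrap n z = i"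
  using wrap_in[of n z] by (intro eq_of_mod_eq'[of _ n _ z]) (auto simp: wrap_mod_diff)

definition cyc_arc :: "nat \<Rightarrow> nat \<Rightarrow> nat \<Rightarrow> nat set" where
  "cyc_arc n r i = {k \<in> {1..n}. (int k - int i) mod int n < int r}"

text \<open>For a position m these are the starts of the arcs through m, that is, the trace of a
  star on the circle. They form a window of r consecutive positions ending in m.\<close>

definition starts :: "nat \<Rightarrow> nat \<Rightarrow> nat \<Rightarrow> nat set" where
  "starts n r m = {i \<in> {1..n}. (int m - int i) mod int n < int r}"

lemma card_cyc_arc: assumes "r \<le> n" shows "card (cyc_arc n r i) = r"
proof (cases "n = 0")
  case True then show ?thesis using assms by (simp add: cyc_arc_def)
next
  case False
  have "bij_betw (\<lambda>k. nat ((int k - int i) mod int n)) (cyc_arc n r i) {..<r}"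
    unfolding bij_betw_def
  proof
    show "inj_on (\<lambda>k. nat ((int k - int i) mod int n)) (cyc_arc n r i)"
      using False by (auto intro!: inj_onI eq_of_mod_eq[where z="int i"] simp: cyc_arc_def eq_nat_nat_iff)
    show "(\<lambda>k. nat ((int k - int i) mod int n)) ` cyc_arc n r i = {..<r}" (is "?f ` _ = _")
    proof (intro equalityI subsetI)
      fix t assume t: "t \<in> {..<r}"
      have "?f (wrap n (int i + int t)) = t" "wrap n (int i + int t) \<in> cyc_arc n r i"
        using False t assms wrap_in[of n "int i + int t"] wrap_mod[of n "int i + int t" "- int i"]
        by (auto simp: cyc_arc_def)
      then show "t \<in> ?f ` cyc_arc n r i" by (intro image_eqI[of t ?f "wrap n (int i + int t)"]) simp_all
    qed (use False in \<open>auto simp: cyc_arc_def nat_less_iff\<close>)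
  qed
  then show ?thesis using bij_betw_same_card by fastforce
qed

lemma card_starts: assumes "r \<le> n" shows "card (starts n r i) = r"
proof (cases "n = 0")
  case True then show ?thesis using assms by (simp add: starts_def)
next
  case False
  have "bij_betw (\<lambda>k. nat ((int i - int k) mod int n)) (starts n r i) {..<r}"
    unfolding bij_betw_def
  proof
    show "inj_on (\<lambda>k. nat ((int i - int k) mod int n)) (starts n r i)"
      using False by (auto intro!: inj_onI eq_of_mod_eq'[where z="int i"] simp: starts_def eq_nat_nat_iff)
    show "(\<lambda>k. nat ((int i - int k) mod int n)) ` starts n r i = {..<r}" (is "?f ` _ = _")
    proof (intro equalityI subsetI)
      fix t assume t: "t \<in> {..<r}"
      have "?f (wrap n (int i - int t)) = t" "wrap n (int i - int t) \<in> starts n r i"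
        using False t assms wrap_in[of n "int i - int t"] wrap_mod_diff[of n "int i" "int i - int t"]
        by (auto simp: starts_def)
      then show "t \<in> ?f ` starts n r i" by (intro image_eqI[of t ?f "wrap n (int i - int t)"]) simp_all
    qed (use False in \<open>auto simp: starts_def nat_less_iff\<close>)
  qed
  then show ?thesis using bij_betw_same_card by fastforce
qed

lemma finite_starts [simp]: "finite (starts n r i)" by (simp add: starts_def)

lemma cyc_arc_in_nsets: "r \<le> n \<Longrightarrow> cyc_arc n r i \<in> nsets {1..n} r"
  by (auto simp: nsets_def card_cyc_arc) (auto simp: cyc_arc_def)

text \<open>A common point at offsets a and b from the starts i and j makes i - j congruent to b -
  a, which lies strictly between -r and r. Residues from r to n - r are thereby impossible.\<close>

lemma mod_diff_far_disjoint_arcs: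
  assumes n: "n > 0" and far: "int r \<le> (int i - int j) mod int n" "(int i - int j) mod int n \<le> int n - int r"
  shows "cyc_arc n r i \<inter> cyc_arc n r j = {}"
proof (rule ccontr)
  assume "cyc_arc n r i \<inter> cyc_arc n r j \<noteq> {}"
  then obtain k where k: "(int k - int i) mod int n < int r" "(int k - int j) mod int n < int r"
    by (auto simp: cyc_arc_def)
  define a b where "a = (int k - int i) mod int n" and "b = (int k - int j) mod int n"
  have ab: "0 \<le> a" "0 \<le> b" "a < int r" "b < int r" using k n by (auto simp: a_def b_def)
  have rn: "int r \<le> int n"
    using far pos_mod_bound[of "int n" "int i - int j"] n by linarith
  have "(int i - int j) mod int n = ((int k - int j) - (int k - int i)) mod int n" by simp
  also have "\<dots> = (b - a) mod int n" unfolding a_def b_def by (simp only: mod_diff_eq)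
  finally have e: "(int i - int j) mod int n = (b - a) mod int n" .
  show False
  proof (cases "b \<ge> a")
    case True
    then have "(b - a) mod int n = b - a" using ab rn by (intro mod_pos_pos_trivial) auto
    then show False using e far ab by simp
  next
    case False
    have "(b - a) mod int n = (b - a + int n) mod int n" by simp
    also have "\<dots> = b - a + int n"
      using ab rn False by (intro mod_pos_pos_trivial) auto
    finally show False using e far ab False by simp
  qed
qed

text \<open>Katona's circle lemma with its equality case. After rotating one of the starts to
  position r - 1, all starts lie in 0, \<dots>, 2 r - 2; of each pair a, a + r at most one occurs, and in the
  equality case the pairs are used consistently because a and a + r + 1 exclude each other as well.\<close>

lemma intersecting_arcs_starts:
  assumes r: "1 \<le> r" "2 * r < n" and T: "T \<subseteq> {1..n}"
    and int: "\<And>i j. i \<in> T \<Longrightarrow> j \<in> T \<Longrightarrow> cyc_arc n r i \<inter> cyc_arc n r j \<noteq> {}"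
  shows "card T \<le> r" and "card T = r \<Longrightarrow> \<exists>m\<in>{1..n}. T = starts n r m"
proof -
  have n: "n > 0" using r by simp
  have finT: "finite T" using T finite_subset by blast
  have nf: "(int i - int j) mod int n < int r \<or> (int i - int j) mod int n > int n - int r"
    if "i \<in> T" "j \<in> T" for i j
    using mod_diff_far_disjoint_arcs[OF n, of r i j] int[OF that] by force
  have "card T \<le> r \<and> (card T = r \<longrightarrow> (\<exists>m\<in>{1..n}. T = starts n r m))"
  proof (cases "T = {}")
    case True then show ?thesis using r by simp
  next
    case False
    then obtain s where s: "s \<in> T" by auto
    define u where "u i = (int i - (int s - int r + 1)) mod int n" for i
    have u0: "0 \<le> u i" "u i < int n" for i using n by (auto simp: u_def)
    have uinj: "inj_on u T" unfolding u_def
      using T by (auto intro!: inj_onI eq_of_mod_eq[where z="int s - int r + 1"])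
    have udiff: "(u i - u j) mod int n = (int i - int j) mod int n" for i j
      unfolding u_def by (simp only: mod_diff_eq) simp
    have us: "u s = int r - 1" using r by (simp add: u_def)
    have ule: "u i \<le> 2 * int r - 2" if "i \<in> T" for i
    proof (rule ccontr)
      assume h: "\<not> ?thesis"
      have "(u i - u s) mod int n = u i - u s" using h u0[of i] us r by (intro mod_pos_pos_trivial) auto
      then show False using nf[OF that s] udiff[of i s] h us u0[of i] by simp
    qed
    \<comment> \<open>The strict inequality 2 r < n enters here: r + 1 is still at most n - r, so
      the distance r + 1 is excluded along with r.\<close>
    have sep: "u i - u j \<noteq> int r" "u i - u j \<noteq> int r + 1" if "i \<in> T" "j \<in> T" for i j
    proof -
      have *: "(u i - u j) mod int n \<noteq> t" if "t = int r \<or> t = int r + 1" for t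
        using nf[OF \<open>i \<in> T\<close> \<open>j \<in> T\<close>] udiff[of i j] that r by auto
      have "int r mod int n = int r" "(int r + 1) mod int n = int r + 1"
        using r by (auto intro!: mod_pos_pos_trivial)
      then show "u i - u j \<noteq> int r" "u i - u j \<noteq> int r + 1" using * by metis+
    qed
    define U where "U = u ` T"
    have U1: "U \<subseteq> {0..2 * int r - 2}" "int r - 1 \<in> U" "finite U"
      using ule u0 us s finT by (auto simp: U_def intro!: image_eqI[of _ u s])
    have U2: "b - a \<noteq> int r" "b - a \<noteq> int r + 1" if "a \<in> U" "b \<in> U" for a b
      using sep that by (auto simp: U_def)
    have cU: "card U = card T" by (simp add: U_def card_image uinj)
    \<comment> \<open>U spans less than 2 r, so two elements in one class modulo r would differ by
      exactly r.\<close>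
    have minj: "inj_on (\<lambda>a. a mod int r) U"
    proof (rule inj_onI, rule ccontr)
      have *: False if "a \<in> U" "b \<in> U" "a mod int r = b mod int r" "a < b" for a b
      proof -
        have "int r dvd b - a" using that by (simp add: mod_eq_dvd_iff[symmetric])
        then obtain k where k: "b - a = int r * k" by auto
        have "0 < int r * k" using that k by linarith
        then have "k > 0" using r by (simp add: zero_less_mult_iff)
        have "int r * k < int r * 2" 
        proof -
          have "0 \<le> a" "b \<le> 2 * int r - 2" using U1(1) that by auto
          then show ?thesis using k by linarith
        qed
        then have "k < 2" using r by simp
        then show False using \<open>k > 0\<close> k U2(1)[OF that(1,2)] by (cases "k = 1") auto
      qed
      fix a b assume "a \<in> U" "b \<in> U" "a mod int r = b mod int r" "a \<noteq> b"
      then show False using *[of a b] *[of b a] by (metis linorder_neqE)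
    qed
    have mim: "(\<lambda>a. a mod int r) ` U \<subseteq> {0..<int r}" using r by auto
    have c1: "card U \<le> r" using card_inj_on_le[OF minj mim] by simp
    have "\<exists>m\<in>{1..n}. T = starts n r m" if cT: "card T = r"
    proof -
      have "card ((\<lambda>a. a mod int r) ` U) = card {0..<int r}"
        using minj cT cU by (simp add: card_image)
      then have surj: "(\<lambda>a. a mod int r) ` U = {0..<int r}"
        using mim by (intro card_subset_eq) auto
      have either: "t \<in> U \<or> t + int r \<in> U" if "0 \<le> t" "t < int r" for t
      proof -
        have "t \<in> (\<lambda>a. a mod int r) ` U" using surj that by simp
        then obtain a where a: "a \<in> U" "t = a mod int r" by auto
        have "0 \<le> a" "a \<le> 2 * int r - 2" using U1 a by auto
        have "a \<in> {t, t + int r}"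
        proof (cases "a < int r")
          case True then show ?thesis using a(2) \<open>0 \<le> a\<close> by (simp add: mod_pos_pos_trivial)
        next
          case False
          have "t = (a - int r) mod int r" using a(2) by simp
          also have "\<dots> = a - int r" using False \<open>a \<le> 2 * int r - 2\<close> by (intro mod_pos_pos_trivial) auto
          finally show ?thesis by simp
        qed
        then show ?thesis using a(1) by auto
      qed
      define k where "k = Max U"
      have "U \<noteq> {}" using U1(2) by blast
      then have kU: "k \<in> U" unfolding k_def by (rule Max_in[OF U1(3)])
      have kmax: "a \<le> k" if "a \<in> U" for a
        unfolding k_def using U1(3) that by (rule Max_ge)
      have kr: "int r - 1 \<le> k" "k \<le> 2 * int r - 2" using kmax U1 kU by auto
      have low: "k - int r + 1 \<le> a" if "a \<in> U" for a
      proof (rule ccontr)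
        assume "\<not> ?thesis"
        then have ak: "a \<le> k - int r" by simp
        have "0 \<le> a" using that U1 by auto
        \<comment> \<open>Downwards from k - r, which is absent because k is present: if t is
          absent, \<open>either\<close> puts t + r into U, and the forbidden distance r + 1 then
          removes t - 1.\<close>
        have "t \<ge> 0 \<longrightarrow> t \<notin> U" if "t \<le> k - int r" for t
          using that
        proof (induction t rule: int_le_induct)
          case base
          then show ?case using kU U2(1)[of "k - int r" k] by auto
        next
          case (step t)
          show ?case
          proof (intro impI notI)
            assume h: "0 \<le> t - 1" "t - 1 \<in> U"
            then have "t + int r \<in> U" using step either[of t] kr by auto
            then show False using U2(2)[OF h(2), of "t + int r"] by auto
          qed
        qed
        then show False using ak that \<open>0 \<le> a\<close> by auto
      qed
      obtain m where m: "m \<in> T" "k = u m" using kU by (auto simp: U_def)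
      have "T \<subseteq> starts n r m"
      proof
        fix i assume i: "i \<in> T"
        have "u i \<in> U" using i by (simp add: U_def)
        then have "0 \<le> u m - u i" "u m - u i < int r" using low kmax m by fastforce+
        then have "(u m - u i) mod int n < int r" using r by (simp add: mod_pos_pos_trivial)
        then show "i \<in> starts n r m" using i T udiff[of m i] by (auto simp: starts_def)
      qed
      then have "T = starts n r m" using cT card_starts[of r n m] r by (intro card_subset_eq) auto
      then show ?thesis using m T by auto
    qed
    then show ?thesis using c1 cU by simp
  qed
  then show "card T \<le> r" "card T = r \<Longrightarrow> \<exists>m\<in>{1..n}. T = starts n r m" by auto
qed

section \<open>Rigidity and cost of adjacent swaps\<close>

text \<open>An arc can change only if it contains exactly one of the positions z and z + 1. Such an
  arc starts at z + 1 or ends at z, and in the latter case it starts at z + 1 - r.\<close>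

lemma swap_adjacent_cyc_arc:
  assumes r: "1 \<le> r" "r < n" and i: "i \<in> {1..n}" "i \<noteq> wrap n (z + 1)" "i \<noteq> wrap n (z + 1 - int r)"
  shows "Transposition.transpose (wrap n z) (wrap n (z + 1)) ` cyc_arc n r i = cyc_arc n r i"
proof (rule transpose_image_eq)
  have n: "n > 0" using r by simp
  define w where "w = (z - int i) mod int n"
  have w: "0 \<le> w" "w < int n" using n by (auto simp: w_def)
  have shift: "(z + c - int i) mod int n = (w + c) mod int n" for c
    unfolding w_def by (simp only: mod_add_left_eq) (simp add: algebra_simps)
  have "w + 1 \<noteq> int n" using wrap_eq[OF i(1), of "z + 1"] shift[of 1] i(2) by auto
  moreover have "w + 1 \<noteq> int r"
    using wrap_eq[OF i(1), of "z + 1 - int r"] shift[of "1 - int r"] i(3) by (auto simp: algebra_simps)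
  moreover have "wrap n z \<in> cyc_arc n r i \<longleftrightarrow> w < int r"
    using wrap_in[OF n, of z] wrap_mod[OF n, of z "- int i"] by (simp add: cyc_arc_def w_def)
  moreover have "wrap n (z + 1) \<in> cyc_arc n r i \<longleftrightarrow> (w + 1) mod int n < int r"
    using wrap_in[OF n, of "z + 1"] wrap_mod[OF n, of "z + 1" "- int i"] shift[of 1]
    by (simp add: cyc_arc_def)
  ultimately show "(wrap n z \<in> cyc_arc n r i) = (wrap n (z + 1) \<in> cyc_arc n r i)"
    using w by (auto simp: mod_pos_pos_trivial)
qed

text \<open>Coordinates relative to m: the two sides of \<open>H\<close> are the windows of starts
  for m and for m' = m + d, and e stands for z + 1, so that e and e - r modulo n are the only places
  where the windows may differ. Testing end points of the windows against these two places refutes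
  every d. The bound e \<ge> 2 says that the swap avoids m; for e = d = 1, the swap of m and m + 1,
  the windows really do differ just there.\<close>

lemma cyclic_interval_shift_contradiction:
  fixes n r d e :: int
  assumes r: "1 \<le> r" "2 * r < n" and d: "1 \<le> d" "d < n" and e: "2 \<le> e" "e < n"
    and H: "\<And>t. 0 \<le> t \<Longrightarrow> t < n \<Longrightarrow> t \<noteq> e \<Longrightarrow> t \<noteq> (if e \<ge> r then e - r else e - r + n) \<Longrightarrow>
        (t = 0 \<or> t > n - r) \<longleftrightarrow> ((t \<le> d \<and> d - t < r) \<or> (t > d \<and> d - t + n < r))"
  shows False
proof -
  define f where "f = (if e \<ge> r then e - r else e - r + n)"
  have K: "t = e \<or> t = f"
    if "0 \<le> t" "t < n" "(t = 0 \<or> t > n - r) \<noteq> ((t \<le> d \<and> d - t < r) \<or> (t > d \<and> d - t + n < r))" for t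
    using H[OF that(1,2), folded f_def] that(3) by argo
  show False
  proof (cases "d \<le> n - r")
    case True
    then have "d = e \<or> d = f" using r d by (intro K) auto
    moreover have "d - 1 = e \<or> d - 1 = f" if "2 \<le> d" "2 \<le> r"
      using r d that True by (intro K) auto
    moreover have "n - r + 1 = e \<or> n - r + 1 = f" if "2 \<le> r"
      using r d that True by (intro K) auto
    moreover have "0 = e \<or> 0 = f" if "r = 1"
      using r d that True by (intro K) auto
    ultimately show False using r d e True unfolding f_def
      by (cases "e \<ge> r"; cases "r = 1"; cases "d = 1"; simp; linarith)
  next
    case False
    then have "0 = e \<or> 0 = f" using r d by (intro K) auto
    moreover have "n - 1 = e \<or> n - 1 = f" if "d < n - 1" using r d False that by (intro K) auto
    moreover have "d - r + 1 = e \<or> d - r + 1 = f" using r d False by (intro K) auto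
    ultimately show False using r d e False unfolding f_def
      by (cases "e \<ge> r"; cases "d < n - 1"; simp; linarith)
  qed
qed

text \<open>The two excluded starts are those of the arcs that a swap of z and z + 1 may change. Two
  different windows of r starts cannot agree everywhere else, so a swap away from m cannot move the
  common position of the arcs.\<close>

lemma starts_eq_outside_two:
  assumes r: "1 \<le> r" "2 * r < n" and m: "m \<in> {1..n}" "m' \<in> {1..n}"
    and z: "wrap n z \<noteq> m" "wrap n (z + 1) \<noteq> m"
    and agree: "\<And>i. i \<in> {1..n} \<Longrightarrow> i \<noteq> wrap n (z + 1) \<Longrightarrow> i \<noteq> wrap n (z + 1 - int r) \<Longrightarrow>
       i \<in> starts n r m \<longleftrightarrow> i \<in> starts n r m'"
  shows "m' = m"
proof (rule ccontr)
  assume "m' \<noteq> m"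
  have n: "n > 0" using r by simp
  define e where "e = (z + 1 - int m) mod int n"
  define d where "d = (int m' - int m) mod int n"
  have e0: "0 \<le> e" "e < int n" and d0: "0 \<le> d" "d < int n" using n by (auto simp: e_def d_def)
  have shift: "(z + 1 - int m + c) mod int n = (e + c) mod int n" for c
    unfolding e_def by (simp only: mod_add_left_eq)
  have "e \<noteq> 0" using wrap_eq[OF m(1), of "z + 1"] z(2) by (auto simp: e_def)
  moreover have "e \<noteq> 1" using wrap_eq[OF m(1), of z] z(1) shift[of "-1"] by auto
  moreover have "d \<noteq> 0" using eq_of_mod_eq[of m' n m "int m"] m \<open>m' \<noteq> m\<close> by (auto simp: d_def)
  ultimately have ed: "1 \<le> d" "2 \<le> e" using e0 d0 by auto
  have er: "(e - int r) mod int n = (if e \<ge> int r then e - int r else e - int r + int n)"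
  proof (cases "e \<ge> int r")
    case True then show ?thesis using e0 by (simp add: mod_pos_pos_trivial)
  next
    case False
    have "(e - int r) mod int n = (e - int r + int n) mod int n" by simp
    also have "\<dots> = e - int r + int n" using False e0 r by (intro mod_pos_pos_trivial) auto
    finally show ?thesis using False by simp
  qed
  show False
  proof (rule cyclic_interval_shift_contradiction[of "int r" "int n" d e])
    fix t :: int
    assume t: "0 \<le> t" "t < int n" "t \<noteq> e"
      "t \<noteq> (if e \<ge> int r then e - int r else e - int r + int n)"
    define i where "i = wrap n (int m + t)"
    have i: "i \<in> {1..n}" using wrap_in[OF n] by (simp add: i_def)
    have im: "(int i - int m) mod int n = t"
      using wrap_mod[OF n, of "int m + t" "- int m"] t by (simp add: i_def)
    have mi: "(c - int i) mod int n = (c - int m - t) mod int n" for c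
      using wrap_mod_diff[OF n, of c "int m + t"] by (simp add: i_def algebra_simps)
    have "i \<noteq> wrap n (z + 1)"
      using im wrap_mod[OF n, of "z + 1" "- int m"] t(3) by (auto simp: e_def)
    moreover have "i \<noteq> wrap n (z + 1 - int r)"
      using im wrap_mod[OF n, of "z + 1 - int r" "- int m"] t(4) shift[of "- int r"] er
      by (auto simp: algebra_simps)
    ultimately have *: "i \<in> starts n r m \<longleftrightarrow> i \<in> starts n r m'" using agree i by blast
    have 1: "(int m - int i) mod int n = (if t = 0 then 0 else int n - t)"
    proof (cases "t = 0")
      case True then show ?thesis using mi[of "int m"] by simp
    next
      case False
      have "(int m - int i) mod int n = (int n - t) mod int n" using mi[of "int m"] by simp
      also have "\<dots> = int n - t" using False t by (intro mod_pos_pos_trivial) auto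
      finally show ?thesis using False by simp
    qed
    have 2: "(int m' - int i) mod int n = (if t \<le> d then d - t else d - t + int n)"
    proof -
      have a: "(int m' - int i) mod int n = (d - t) mod int n"
        using mi[of "int m'"] unfolding d_def by (simp only: mod_diff_left_eq)
      show ?thesis
      proof (cases "t \<le> d")
        case True then show ?thesis using a d0 t by (simp add: mod_pos_pos_trivial)
      next
        case False
        have "(d - t) mod int n = (d - t + int n) mod int n" by simp
        also have "\<dots> = d - t + int n" using False d0 t by (intro mod_pos_pos_trivial) auto
        finally show ?thesis using a False by simp
      qed
    qed
    show "(t = 0 \<or> t > int n - int r) \<longleftrightarrow>
        ((t \<le> d \<and> d - t < int r) \<or> (t > d \<and> d - t + int n < int r))"
      using * i 1 2 r by (auto simp: starts_def split: if_splits)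
  qed (use r ed e0 d0 in auto)
qed

text \<open>A transposition of entries k + 1 places apart is a product of 2 k + 1 adjacent ones, and
  a permutation of L points is a product of at most L transpositions. Only the polynomial order of
  the bound matters. Later \<open>c\<close> counts the members of a class that a rearrangement
  expels.\<close>

lemma subadditive_permutation_cost:
  fixes c :: "(nat \<Rightarrow> nat) \<Rightarrow> nat"
  assumes p: "inj_on p {..<L}" and c0: "c id = 0"
    and sub: "\<And>\<sigma> \<tau>. \<sigma> permutes p ` {..<L} \<Longrightarrow> \<tau> permutes p ` {..<L} \<Longrightarrow> c (\<sigma> \<circ> \<tau>) \<le> c \<sigma> + c \<tau>"
    and adj: "\<And>j. Suc j < L \<Longrightarrow> c (Transposition.transpose (p j) (p (Suc j))) \<le> B"
    and \<tau>: "\<tau> permutes p ` {..<L}"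
  shows "c \<tau> \<le> L * (2 * L * B)"
proof -
  let ?P = "p ` {..<L}"
  have up: "c (Transposition.transpose (p j) (p (Suc (j + k)))) \<le> (2 * k + 1) * B"
    if "Suc (j + k) < L" for j k
    using that
  proof (induction k)
    case 0 then show ?case using adj[of j] by simp
  next
    case (Suc k)
    let ?s = "Transposition.transpose (p (Suc (j + k))) (p (Suc (j + Suc k)))"
    let ?t = "Transposition.transpose (p j) (p (Suc (j + k)))"
    have ne: "p j \<noteq> p (Suc (j + k))" "p j \<noteq> p (Suc (j + Suc k))" "p (Suc (j + k)) \<noteq> p (Suc (j + Suc k))"
      using Suc.prems by (auto simp: inj_on_eq_iff[OF p])
    \<comment> \<open>Conjugation by an adjacent swap carries the far end one place further, at an
      additional cost of 2 B.\<close>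
    have eq: "Transposition.transpose (p j) (p (Suc (j + Suc k))) = ?s \<circ> (?t \<circ> ?s)"
      using ne by (auto simp: fun_eq_iff Transposition.transpose_def)
    have s: "?s permutes ?P" and t: "?t permutes ?P"
      using Suc.prems by (auto intro!: permutes_swap_id)
    have "c (?s \<circ> (?t \<circ> ?s)) \<le> c ?s + (c ?t + c ?s)"
      using sub[OF s permutes_compose[OF s t]] sub[OF t s] by linarith
    also have "\<dots> \<le> B + ((2 * k + 1) * B + B)"
      using Suc adj[of "Suc (j + k)"] by (intro add_mono) auto
    also have "\<dots> = (2 * Suc k + 1) * B" by simp
    finally show ?case unfolding eq .
  qed
  have swap: "c (Transposition.transpose a b) \<le> 2 * L * B" if ab: "a \<in> ?P" "b \<in> ?P" for a b
  proof -
    have *: "c (Transposition.transpose (p i) (p j)) \<le> 2 * L * B" if "i < j" "j < L" for i j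
    proof -
      obtain k where k: "j = Suc (i + k)" using \<open>i < j\<close> less_natE by blast
      have "(2 * k + 1) * B \<le> 2 * L * B" using that k by (intro mult_right_mono) auto
      then show ?thesis using up[of i k] that k by auto
    qed
    obtain i j where ij: "a = p i" "b = p j" "i < L" "j < L" using ab by auto
    consider "i < j" | "i = j" | "j < i" by linarith
    then show ?thesis
    proof cases
      case 1 then show ?thesis using * ij by auto
    next
      case 2 then show ?thesis using ij c0 by simp
    next
      case 3 then show ?thesis using *[of j i] ij by (simp add: transpose_commute)
    qed
  qed
  have main: "c \<tau> \<le> card Q * (2 * L * B)" if "finite Q" "Q \<subseteq> ?P" "\<tau> permutes Q" for Q \<tau>
    using that
  proof (induction Q arbitrary: \<tau> rule: finite_induct)
    case empty then show ?case using c0 by (metis permutes_empty le0)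
  next
    case (insert a Q)
    \<comment> \<open>Composing with this transposition makes a a fixed point, so one transposition
      is spent per point.\<close>
    let ?t = "Transposition.transpose a (\<tau> a)"
    have q: "(?t \<circ> \<tau>) permutes Q" using permutes_insert_lemma[OF insert.prems(2)] .
    have "\<tau> a \<in> insert a Q" using permutes_in_image[OF insert.prems(2), of a] by blast
    then have a: "a \<in> ?P" "\<tau> a \<in> ?P" using insert.prems(1) by auto
    have "\<tau> = ?t \<circ> (?t \<circ> \<tau>)" by (simp add: fun_eq_iff)
    then have "c \<tau> \<le> c ?t + c (?t \<circ> \<tau>)"
      using sub[of ?t "?t \<circ> \<tau>"] permutes_swap_id[OF a] permutes_subset[OF q] insert.prems(1)
      by (metis insert_subset)
    also have "\<dots> \<le> 2 * L * B + card Q * (2 * L * B)"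
      using insert.prems(1) by (intro add_mono swap[OF a] insert.IH[OF _ q]) simp
    finally show ?case using insert.hyps by simp
  qed
  have "card ?P = L" using p by (simp add: card_image)
  then show ?thesis using main[OF _ subset_refl \<tau>] by simp
qed

section \<open>Supersaturation by the circle method\<close>

abbreviation star :: "nat \<Rightarrow> nat \<Rightarrow> nat \<Rightarrow> nat set set" where
  "star n r x \<equiv> {B \<in> nsets {1..n} r. x \<in> B}"

abbreviation perms :: "nat \<Rightarrow> (nat \<Rightarrow> nat) set" where
  "perms n \<equiv> {\<pi>. \<pi> permutes {1..n}}"

definition inner_pairs :: "nat \<Rightarrow> nat \<Rightarrow> nat set set \<Rightarrow> (nat set \<times> nat set) set" where
  "inner_pairs n r F = disjoint_pairs {1..n} r \<inter> F \<times> F"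

context
  fixes n r :: nat and F :: "nat set set"
  assumes r1: "1 \<le> r" and rn: "2 * r < n" and F: "F \<subseteq> nsets {1..n} r"
begin

text \<open>Convention: \<pi> k is the element placed at position k, so the image of an arc is the
  set of elements read off along it.\<close>

definition occ :: "(nat \<Rightarrow> nat) \<Rightarrow> nat set" where
  "occ \<pi> = {i \<in> {1..n}. \<pi> ` cyc_arc n r i \<in> F}"

definition bad :: "(nat \<Rightarrow> nat) set" where
  "bad = {\<pi> \<in> perms n. \<exists>i\<in>occ \<pi>. \<exists>j\<in>occ \<pi>. cyc_arc n r i \<inter> cyc_arc n r j = {}}"

definition nice :: "nat \<Rightarrow> (nat \<Rightarrow> nat) set" where
  "nice m = {\<pi> \<in> perms n. occ \<pi> = starts n r m}"

text \<open>This includes \<open>bad\<close>, because the arcs of a nice permutation share the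
  position m. By the equality case of the circle lemma, the other members have fewer than r arcs in
  F.\<close>

definition rough :: "(nat \<Rightarrow> nat) set" where
  "rough = perms n - (\<Union>m\<in>{1..n}. nice m)"

definition nice_at :: "nat \<Rightarrow> nat \<Rightarrow> (nat \<Rightarrow> nat) set" where
  "nice_at m x = {\<pi> \<in> nice m. \<pi> m = x}"

lemma finite_perms: "finite (perms n)" by (simp add: finite_permutations)

lemma card_perms: "card (perms n) = fact n" by (simp add: card_permutations)

lemma finite_classes: "finite bad" "finite rough" "finite (nice_at m x)"
  by (rule finite_subset[OF _ finite_perms], auto simp: bad_def rough_def nice_def nice_at_def)+

text \<open>Each of the n arcs has a uniform image, so the average number of arcs in F is n |F| / V.
  For |F| = N + 1 this is r + n / V, because V r = n N.\<close>

lemma sum_card_occ: "(n choose r) * (\<Sum>\<pi>\<in>perms n. card (occ \<pi>)) = n * card F * fact n"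
proof -
  have "(\<Sum>\<pi>\<in>perms n. card (occ \<pi>)) = (\<Sum>\<pi>\<in>perms n. \<Sum>i\<in>{1..n}. if \<pi> ` cyc_arc n r i \<in> F then 1 else 0)"
    by (intro sum.cong refl) (simp add: occ_def sum.If_cases Int_def)
  also have "\<dots> = (\<Sum>i\<in>{1..n}. \<Sum>\<pi>\<in>perms n. if \<pi> ` cyc_arc n r i \<in> F then 1 else 0)"
    by (rule sum.swap)
  also have "\<dots> = (\<Sum>i\<in>{1..n}. card {\<pi>. \<pi> permutes {1..n} \<and> \<pi> ` cyc_arc n r i \<in> F})"
    using finite_perms by (intro sum.cong refl) (simp add: sum.If_cases Int_def)
  finally have "(n choose r) * (\<Sum>\<pi>\<in>perms n. card (occ \<pi>)) =
    (\<Sum>i\<in>{1..n}. (n choose r) * card {\<pi>. \<pi> permutes {1..n} \<and> \<pi> ` cyc_arc n r i \<in> F})"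
    by (simp add: sum_distrib_left)
  also have "\<dots> = (\<Sum>i\<in>{1..n}. card F * fact n)"
    using card_permutations_image_in[of "{1..n}" _ r F] F cyc_arc_in_nsets[of r n] rn
    by (intro sum.cong refl) simp
  finally show ?thesis by simp
qed

text \<open>Union bound over at most n^2 pairs of disjoint arcs: the image of each is a uniform
  ordered disjoint pair, one of V D.\<close>

lemma card_bad_le:
  "(n choose r) * ((n - r) choose r) * card bad \<le> n\<^sup>2 * (card (inner_pairs n r F) * fact n)"
proof -
  let ?I = "{(i, j) \<in> {1..n} \<times> {1..n}. cyc_arc n r i \<inter> cyc_arc n r j = {}}"
  let ?B = "\<lambda>(i, j). {\<pi>. \<pi> permutes {1..n} \<and> (\<pi> ` cyc_arc n r i, \<pi> ` cyc_arc n r j) \<in> inner_pairs n r F}"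
  let ?VD = "(n choose r) * ((n - r) choose r)"
  have sub: "bad \<subseteq> (\<Union>ij\<in>?I. ?B ij)"
  proof
    fix \<pi> assume "\<pi> \<in> bad"
    then obtain i j where p: "\<pi> permutes {1..n}" "i \<in> occ \<pi>" "j \<in> occ \<pi>" "cyc_arc n r i \<inter> cyc_arc n r j = {}"
      by (auto simp: bad_def)
    have "\<pi> ` cyc_arc n r i \<inter> \<pi> ` cyc_arc n r j = {}"
      using p permutes_inj[OF p(1)] by (simp add: image_Int[symmetric])
    then have "(\<pi> ` cyc_arc n r i, \<pi> ` cyc_arc n r j) \<in> inner_pairs n r F"
      using p F by (auto simp: occ_def inner_pairs_def disjoint_pairs_def)
    then have "(i, j) \<in> ?I" "\<pi> \<in> ?B (i, j)" using p by (auto simp: occ_def)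
    then show "\<pi> \<in> (\<Union>ij\<in>?I. ?B ij)" by (rule UN_I)
  qed
  have finI: "finite ?I" by (rule finite_subset[of _ "{1..n} \<times> {1..n}"]) auto
  have finB: "finite (?B ij)" for ij
    by (cases ij) (auto intro: finite_subset[OF _ finite_perms])
  have "card bad \<le> card (\<Union>ij\<in>?I. ?B ij)"
    using sub finI finB by (intro card_mono) blast+
  also have "\<dots> \<le> (\<Sum>ij\<in>?I. card (?B ij))" using finI by (rule card_UN_le)
  finally have "card bad \<le> (\<Sum>ij\<in>?I. card (?B ij))" .
  then have "?VD * card bad \<le> (\<Sum>ij\<in>?I. ?VD * card (?B ij))"
    by (simp add: sum_distrib_left[symmetric])
  also have "\<dots> = (\<Sum>ij\<in>?I. card (inner_pairs n r F) * fact n)"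
  proof (intro sum.cong refl)
    fix ij assume "ij \<in> ?I"
    then obtain i j where ij: "ij = (i, j)" "cyc_arc n r i \<inter> cyc_arc n r j = {}" by auto
    then have "(cyc_arc n r i, cyc_arc n r j) \<in> disjoint_pairs {1..n} r"
      using cyc_arc_in_nsets[of r n] rn by (simp add: disjoint_pairs_def)
    from card_permutations_pair_in[OF _ this, of "inner_pairs n r F"]
    show "?VD * card (?B ij) = card (inner_pairs n r F) * fact n"
      using ij by (simp add: inner_pairs_def)
  qed
  also have "\<dots> = card ?I * (card (inner_pairs n r F) * fact n)" by simp
  also have "\<dots> \<le> n\<^sup>2 * (card (inner_pairs n r F) * fact n)"
  proof (rule mult_right_mono)
    have "card ?I \<le> card ({1..n} \<times> {1..n})" by (intro card_mono) auto
    then show "card ?I \<le> n\<^sup>2" by (simp add: card_cartesian_product power2_eq_square)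
  qed simp
  finally show ?thesis .
qed

lemma binomial_star: "(n choose r) * r = n * ((n - 1) choose (r - 1))"
  using times_binomial_minus1_eq[of r n] r1 by (simp add: mult.commute)

text \<open>A permutation without disjoint arcs in F sees at most r members of F, and at most r - 1 if it is
  rough; but the average is slightly more than r.\<close>

lemma rough_bound:
  assumes cF: "card F = Suc ((n - 1) choose (r - 1))"
  shows "(n choose r) * card rough + n * fact n \<le> Suc n * ((n choose r) * card bad)"
proof -
  let ?V = "n choose r" and ?N = "(n - 1) choose (r - 1)"
  \<comment> \<open>A bad permutation may carry up to n arcs from F and be rough besides; the weight
    n + 1 covers both.\<close>
  have pt: "card (occ \<pi>) + of_bool (\<pi> \<in> rough) \<le> r + Suc n * of_bool (\<pi> \<in> bad)"
    if \<pi>: "\<pi> \<in> perms n" for \<pi>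
  proof (cases "\<pi> \<in> bad")
    case True
    have "card (occ \<pi>) \<le> card {1..n}" by (intro card_mono) (auto simp: occ_def)
    then show ?thesis using True by simp
  next
    case False
    have occ: "occ \<pi> \<subseteq> {1..n}" by (auto simp: occ_def)
    have ne: "cyc_arc n r i \<inter> cyc_arc n r j \<noteq> {}" if "i \<in> occ \<pi>" "j \<in> occ \<pi>" for i j
      using False \<pi> that by (auto simp: bad_def)
    note K = intersecting_arcs_starts[OF r1 rn occ ne]
    have "card (occ \<pi>) \<noteq> r" if "\<pi> \<in> rough"
      using K(2) \<pi> that by (auto simp: rough_def nice_def)
    then show ?thesis using K(1) False by auto
  qed
  have "(\<Sum>\<pi>\<in>perms n. card (occ \<pi>)) + card rough
      = (\<Sum>\<pi>\<in>perms n. card (occ \<pi>) + of_bool (\<pi> \<in> rough))"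
  proof -
    have "perms n \<inter> rough = rough" by (auto simp: rough_def)
    then have "(\<Sum>\<pi>\<in>perms n. of_bool (\<pi> \<in> rough)) = card rough"
      using finite_perms by simp
    then show ?thesis by (simp add: sum.distrib)
  qed
  also have "\<dots> \<le> (\<Sum>\<pi>\<in>perms n. r + Suc n * of_bool (\<pi> \<in> bad))" by (intro sum_mono pt)
  also have "\<dots> = fact n * r + Suc n * card bad"
  proof -
    have "perms n \<inter> bad = bad" by (auto simp: bad_def)
    then have "(\<Sum>\<pi>\<in>perms n. of_bool (\<pi> \<in> bad)) = card bad"
      using finite_perms by simp
    then show ?thesis using card_perms by (simp add: sum.distrib sum_distrib_left[symmetric])
  qed
  finally have "?V * ((\<Sum>\<pi>\<in>perms n. card (occ \<pi>)) + card rough) \<le> ?V * (fact n * r + Suc n * card bad)"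
    by (intro mult_left_mono) simp_all
  \<comment> \<open>Since n N = V r, the left side exceeds V r (n!) by n (n!): the single vertex
    beyond the size of a star yields the surplus in the conclusion.\<close>
  then have "n * Suc ?N * fact n + ?V * card rough \<le> (?V * r) * fact n + Suc n * (?V * card bad)"
    by (simp only: distrib_left sum_card_occ cF ac_simps)
  then have "n * Suc ?N * fact n + ?V * card rough \<le> n * ?N * fact n + Suc n * (?V * card bad)"
    by (simp only: binomial_star)
  then show ?thesis by (simp add: distrib_right)
qed

lemma occ_comp_swap:
  assumes m: "m \<in> {1..n}" "m' \<in> {1..n}"
    and z: "wrap n z \<noteq> m" "wrap n (z + 1) \<noteq> m"
    and \<pi>: "\<pi> \<in> nice m" "\<pi> \<circ> Transposition.transpose (wrap n z) (wrap n (z + 1)) \<in> nice m'"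
  shows "m' = m"
proof (rule starts_eq_outside_two[OF r1 rn m z])
  fix i assume i: "i \<in> {1..n}" "i \<noteq> wrap n (z + 1)" "i \<noteq> wrap n (z + 1 - int r)"
  let ?t = "Transposition.transpose (wrap n z) (wrap n (z + 1))"
  have "?t ` cyc_arc n r i = cyc_arc n r i"
    using r1 rn i by (intro swap_adjacent_cyc_arc) auto
  then have "(\<pi> \<circ> ?t) ` cyc_arc n r i = \<pi> ` cyc_arc n r i" by (simp only: image_comp[symmetric])
  then have "i \<in> occ \<pi> \<longleftrightarrow> i \<in> occ (\<pi> \<circ> ?t)" by (simp only: occ_def mem_Collect_eq)
  then show "i \<in> starts n r m \<longleftrightarrow> i \<in> starts n r m'" using \<pi> by (simp add: nice_def)
qed

lemma nice_at_subset: "nice_at m x \<subseteq> {\<pi>. \<pi> permutes {1..n} \<and> \<pi> m = x}"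
  by (auto simp: nice_at_def nice_def)

text \<open>The swap fixes m, so x stays at position m and the class can be left only by losing
  niceness at m. Niceness at another position is impossible by \<open>occ_comp_swap\<close>; hence
  the swap maps the expelled permutations injectively into \<open>rough\<close>.\<close>

lemma swap_cost_le:
  assumes m: "m \<in> {1..n}" and z: "wrap n z \<noteq> m" "wrap n (z + 1) \<noteq> m"
  shows "card {\<pi> \<in> nice_at m x. \<pi> \<circ> Transposition.transpose (wrap n z) (wrap n (z + 1)) \<notin> nice_at m x}
    \<le> card rough"
proof -
  let ?t = "Transposition.transpose (wrap n z) (wrap n (z + 1))"
  have t: "?t permutes {1..n}" using wrap_in rn by (intro permutes_swap_id) simp_all
  show ?thesis
  proof (rule card_inj_on_le[where f="\<lambda>\<pi>. \<pi> \<circ> ?t"])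
    show "inj_on (\<lambda>\<pi>. \<pi> \<circ> ?t) {\<pi> \<in> nice_at m x. \<pi> \<circ> ?t \<notin> nice_at m x}"
      by (rule inj_onI) (metis comp_id fun.map_comp transpose_comp_involutory)
    show "(\<lambda>\<pi>. \<pi> \<circ> ?t) ` {\<pi> \<in> nice_at m x. \<pi> \<circ> ?t \<notin> nice_at m x} \<subseteq> rough"
    proof (rule image_subsetI)
      fix \<pi> assume "\<pi> \<in> {\<pi> \<in> nice_at m x. \<pi> \<circ> ?t \<notin> nice_at m x}"
      then have \<pi>: "\<pi> \<in> nice m" "\<pi> m = x" "\<pi> \<circ> ?t \<notin> nice_at m x" by (auto simp: nice_at_def)
      have "?t m = m" using z by (simp add: transpose_apply_other)
      then have "\<pi> \<circ> ?t \<notin> nice m" using \<pi> by (auto simp: nice_at_def)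
      then have "\<pi> \<circ> ?t \<notin> nice m'" if "m' \<in> {1..n}" for m'
        using occ_comp_swap[OF m that z \<pi>(1)] by auto
      moreover have "\<pi> \<circ> ?t permutes {1..n}"
        using \<pi>(1) permutes_compose[OF t] by (auto simp: nice_def)
      ultimately show "\<pi> \<circ> ?t \<in> rough" by (simp add: rough_def)
    qed
  qed (rule finite_classes)
qed

text \<open>Count the pairs of a permutation in the class and a rearrangement of the positions other than m
  that leads out of the class: by adjacent swaps few pairs leave it, whereas a class
  that is neither almost empty nor almost full would have many.\<close>

lemma nice_at_product_bound:
  assumes m: "m \<in> {1..n}"
  shows "card (nice_at m x) * card ({\<pi>. \<pi> permutes {1..n} \<and> \<pi> m = x} - nice_at m x)
    \<le> fact (n - 1) * (2 * n\<^sup>2 * card rough)"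
proof -
  let ?H = "nice_at m x" and ?\<Omega> = "{\<pi>. \<pi> permutes {1..n} \<and> \<pi> m = x}"
  define c where "c \<tau> = card {\<pi> \<in> ?H. \<pi> \<circ> \<tau> \<notin> ?H}" for \<tau>
  \<comment> \<open>The positions other than m, enumerated around the circle from m + 1 on:
    consecutive entries are neighbours on the circle and no swap among them touches m.\<close>
  define p where "p j = wrap n (int m + 1 + int j)" for j
  have n: "n > 0" using rn by simp
  have p_mod: "(int (p j) - int m) mod int n = int j + 1" if "j < n - 1" for j
    using wrap_mod[OF n, of "int m + 1 + int j" "- int m"] that by (simp add: p_def mod_pos_pos_trivial)
  have inj: "inj_on p {..<n - 1}"
    by (rule inj_onI) (metis p_mod lessThan_iff add_right_cancel of_nat_eq_iff)
  have p_ne: "p j \<noteq> m" if "j < n - 1" for j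
    using p_mod[OF that] by auto
  have "p ` {..<n - 1} \<subseteq> {1..n} - {m}"
    using p_ne wrap_in[OF n] by (auto simp: p_def simp del: atLeastAtMost_iff)
  moreover have "card (p ` {..<n - 1}) = card ({1..n} - {m})"
    using inj m by (simp add: card_image)
  ultimately have P: "p ` {..<n - 1} = {1..n} - {m}" by (intro card_subset_eq) auto
  have finH: "finite ?H" by (rule finite_classes)
  have cost: "c \<tau> \<le> (n - 1) * (2 * (n - 1) * card rough)" if "\<tau> permutes {1..n} - {m}" for \<tau>
  proof (rule subadditive_permutation_cost[where c=c and B="card rough", OF inj])
    show "c id = 0" by (simp add: c_def)
    show "c (\<sigma> \<circ> \<tau>) \<le> c \<sigma> + c \<tau>" if "\<sigma> permutes p ` {..<n - 1}" for \<sigma> \<tau>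
    proof -
      let ?A = "{\<pi> \<in> ?H. \<pi> \<circ> \<sigma> \<notin> ?H}" and ?B = "{\<pi> \<in> ?H. \<pi> \<circ> \<sigma> \<in> ?H \<and> \<pi> \<circ> \<sigma> \<circ> \<tau> \<notin> ?H}"
      have "{\<pi> \<in> ?H. \<pi> \<circ> (\<sigma> \<circ> \<tau>) \<notin> ?H} \<subseteq> ?A \<union> ?B" by (auto simp: o_assoc)
      then have "c (\<sigma> \<circ> \<tau>) \<le> card (?A \<union> ?B)"
        unfolding c_def using finH by (intro card_mono) auto
      also have "\<dots> \<le> card ?A + card ?B" by (rule card_Un_le)
      also have "card ?B \<le> c \<tau>" unfolding c_def
      proof (rule card_inj_on_le[where f="\<lambda>\<pi>. \<pi> \<circ> \<sigma>"])
        show "inj_on (\<lambda>\<pi>. \<pi> \<circ> \<sigma>) ?B"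
          by (rule inj_onI) (metis comp_id fun.map_comp permutes_inv_o(1) that)
      qed (use finH in auto)
      finally show ?thesis by (simp only: c_def)
    qed
    show "c (Transposition.transpose (p j) (p (Suc j))) \<le> card rough" if "Suc j < n - 1" for j
      unfolding c_def p_def
      using swap_cost_le[OF m, of "int m + 1 + int j" x] p_ne[of j] p_ne[of "Suc j"] that
      by (simp add: p_def algebra_simps)
    show "\<tau> permutes p ` {..<n - 1}" using that P by simp
  qed
  let ?Q = "{\<tau>. \<tau> permutes {1..n} - {m}}"
  have finQ: "finite ?Q" by (simp add: finite_permutations)
  have cQ: "card ?Q = fact (n - 1)" using m by (simp add: card_permutations)
  \<comment> \<open>Any \<rho> outside the class with \<rho> m = x is reached from \<pi> by the
    rearrangement inv \<pi> \<circ> \<rho>, which fixes m. So each member of the class is expelled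
    by at least as many rearrangements as there are such \<rho>.\<close>
  have fib: "card (?\<Omega> - ?H) \<le> card {\<tau> \<in> ?Q. \<pi> \<circ> \<tau> \<notin> ?H}" if \<pi>: "\<pi> \<in> ?H" for \<pi>
  proof (rule card_inj_on_le[where f="\<lambda>\<rho>. inv \<pi> \<circ> \<rho>"])
    have \<pi>p: "\<pi> permutes {1..n}" "\<pi> m = x" using \<pi> nice_at_subset by auto
    have inv: "inv \<pi> permutes {1..n}" using \<pi>p(1) by (rule permutes_inv)
    show "inj_on (\<lambda>\<rho>. inv \<pi> \<circ> \<rho>) (?\<Omega> - ?H)" using inv by (rule inj_on_comp_permutes)
    show "(\<lambda>\<rho>. inv \<pi> \<circ> \<rho>) ` (?\<Omega> - ?H) \<subseteq> {\<tau> \<in> ?Q. \<pi> \<circ> \<tau> \<notin> ?H}"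
    proof (rule image_subsetI)
      fix \<rho> assume \<rho>: "\<rho> \<in> ?\<Omega> - ?H"
      have q: "inv \<pi> \<circ> \<rho> permutes {1..n}" using \<rho> inv by (auto intro: permutes_compose)
      have "(inv \<pi> \<circ> \<rho>) m = m" using \<rho> \<pi>p by (simp add: permutes_inv_eq)
      then have "inv \<pi> \<circ> \<rho> permutes {1..n} - {m}"
        by (intro permutes_superset[OF q]) auto
      moreover have "\<pi> \<circ> (inv \<pi> \<circ> \<rho>) = \<rho>"
        using permutes_inv_o(1)[OF \<pi>p(1)] by (simp add: o_assoc)
      ultimately show "inv \<pi> \<circ> \<rho> \<in> {\<tau> \<in> ?Q. \<pi> \<circ> \<tau> \<notin> ?H}" using \<rho> by simp
    qed
  qed (use finQ in simp)
  have "card ?H * card (?\<Omega> - ?H) = (\<Sum>\<pi>\<in>?H. card (?\<Omega> - ?H))" by simp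
  also have "\<dots> \<le> (\<Sum>\<pi>\<in>?H. card {\<tau> \<in> ?Q. \<pi> \<circ> \<tau> \<notin> ?H})" by (intro sum_mono fib)
  also have "\<dots> = (\<Sum>\<tau>\<in>?Q. c \<tau>)" unfolding c_def
    using sum_multicount_gen[OF finH finQ, of "\<lambda>\<pi> \<tau>. \<pi> \<circ> \<tau> \<notin> ?H" "\<lambda>\<tau>. card {\<pi> \<in> ?H. \<pi> \<circ> \<tau> \<notin> ?H}"]
    by simp
  also have "\<dots> \<le> (\<Sum>\<tau>\<in>?Q. (n - 1) * (2 * (n - 1) * card rough))"
    using cost by (intro sum_mono) simp
  also have "\<dots> = fact (n - 1) * ((n - 1) * (2 * (n - 1) * card rough))" by (simp only: sum_constant cQ of_nat_id)
  also have "\<dots> \<le> fact (n - 1) * (2 * n\<^sup>2 * card rough)"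
  proof (rule mult_left_mono)
    have "(n - 1) * (n - 1) \<le> n * n" by (intro mult_mono) auto
    then have "2 * ((n - 1) * (n - 1)) * card rough \<le> 2 * (n * n) * card rough" by (intro mult_right_mono) auto
    then show "(n - 1) * (2 * (n - 1) * card rough) \<le> 2 * n\<^sup>2 * card rough"
      by (simp add: power2_eq_square ac_simps)
  qed simp
  finally show ?thesis .
qed

text \<open>If the arc starting at m reads a member of the star that is missing from F, then an arc
  through m is not in F and \<pi> is not nice at m. Given \<pi> m = x this arc is uniform on the
  star, so every missing member contributes a fraction 1 / N of the permutations.\<close>

lemma star_deficit_le:
  assumes m: "m \<in> {1..n}" and x: "x \<in> {1..n}"
  shows "card (star n r x - F) * fact (n - 1)
    \<le> ((n - 1) choose (r - 1)) * card ({\<pi>. \<pi> permutes {1..n} \<and> \<pi> m = x} - nice_at m x)"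
proof -
  have ma: "m \<in> cyc_arc n r m" using m r1 by (simp add: cyc_arc_def)
  have ms: "m \<in> starts n r m" using m r1 by (simp add: starts_def)
  let ?G = "star n r x - F"
  have "{\<pi>. \<pi> permutes {1..n} \<and> \<pi> m = x \<and> \<pi> ` cyc_arc n r m \<in> ?G}
    \<subseteq> {\<pi>. \<pi> permutes {1..n} \<and> \<pi> m = x} - nice_at m x"
    using ms by (auto simp: nice_at_def nice_def occ_def)
  then have le: "card {\<pi>. \<pi> permutes {1..n} \<and> \<pi> m = x \<and> \<pi> ` cyc_arc n r m \<in> ?G}
    \<le> card ({\<pi>. \<pi> permutes {1..n} \<and> \<pi> m = x} - nice_at m x)"
    by (intro card_mono) (auto intro: finite_subset[OF _ finite_perms])
  have "((card {1..n} - 1) choose (r - 1)) *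
      card {\<pi>. \<pi> permutes {1..n} \<and> \<pi> m = x \<and> \<pi> ` cyc_arc n r m \<in> ?G} = card ?G * fact (card {1..n} - 1)"
    using rn by (intro card_permutations_point_image_in[OF finite_atLeastAtMost ma x cyc_arc_in_nsets r1]) auto
  then have eq: "((n - 1) choose (r - 1)) *
      card {\<pi>. \<pi> permutes {1..n} \<and> \<pi> m = x \<and> \<pi> ` cyc_arc n r m \<in> ?G} = card ?G * fact (n - 1)"
    by (simp only: card_atLeastAtMost diff_Suc_1)
  show ?thesis unfolding eq[symmetric] by (rule mult_le_mono2[OF le])
qed

text \<open>Pigeonhole: the rough permutations and the n^2 classes \<open>nice_at m x\<close> cover
  all permutations.\<close>

lemma exists_large_nice_at:
  "\<exists>m\<in>{1..n}. \<exists>x\<in>{1..n}. fact n \<le> card rough + n\<^sup>2 * card (nice_at m x)"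
proof (rule ccontr)
  assume "\<not> ?thesis"
  then have small: "card rough + n\<^sup>2 * card (nice_at m x) < fact n" if "m \<in> {1..n}" "x \<in> {1..n}" for m x
    using that by force
  let ?I = "{1..n} \<times> {1..n}"
  define M where "M = Max ((\<lambda>(m, x). card (nice_at m x)) ` ?I)"
  have n: "n > 0" using rn by simp
  have fne: "finite ((\<lambda>(m, x). card (nice_at m x)) ` ?I)" "(\<lambda>(m, x). card (nice_at m x)) ` ?I \<noteq> {}"
    using n by auto
  obtain m0 x0 where m0: "m0 \<in> {1..n}" "x0 \<in> {1..n}" "M = card (nice_at m0 x0)"
    using Max_in[OF fne] by (auto simp: M_def)
  have le: "card (nice_at m x) \<le> M" if "m \<in> {1..n}" "x \<in> {1..n}" for m x
    unfolding M_def using that by (intro Max_ge[OF fne(1)]) (auto intro!: image_eqI[of _ _ "(m, x)"])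
  have "perms n \<subseteq> rough \<union> (\<Union>(m, x)\<in>?I. nice_at m x)"
  proof
    fix \<pi> assume \<pi>: "\<pi> \<in> perms n"
    show "\<pi> \<in> rough \<union> (\<Union>(m, x)\<in>?I. nice_at m x)"
    proof (cases "\<pi> \<in> rough")
      case False
      then obtain m where m: "m \<in> {1..n}" "\<pi> \<in> nice m" using \<pi> by (auto simp: rough_def)
      then have "\<pi> m \<in> {1..n}" using \<pi> permutes_in_image[of \<pi> "{1..n}" m] by simp
      then have "(m, \<pi> m) \<in> ?I" "\<pi> \<in> nice_at m (\<pi> m)" using m by (auto simp: nice_at_def)
      then show ?thesis by blast
    qed simp
  qed
  then have "fact n \<le> card (rough \<union> (\<Union>(m, x)\<in>?I. nice_at m x))"
    using finite_classes by (subst card_perms[symmetric], intro card_mono) auto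
  also have "\<dots> \<le> card rough + card (\<Union>(m, x)\<in>?I. nice_at m x)" by (rule card_Un_le)
  also have "card (\<Union>(m, x)\<in>?I. nice_at m x) \<le> (\<Sum>(m, x)\<in>?I. card (nice_at m x))"
    using card_UN_le[of ?I "\<lambda>(m, x). nice_at m x"] by (simp add: case_prod_unfold)
  also have "\<dots> \<le> (\<Sum>(m, x)\<in>?I. M)" using le by (intro sum_mono) auto
  also have "\<dots> = n\<^sup>2 * M" by (simp add: power2_eq_square)
  finally show False using small[OF m0(1,2)] m0(3) by simp
qed

text \<open>As |F| = N + 1, the factor 2 |star - F| + 1 is the size of the symmetric difference. The
  deficit |star - F| contributes twice 8 n^7 and the summand 1 contributes 2 n^7, whence 18.\<close>

lemma Kneser_supersaturation_circle:
  assumes cF: "card F = Suc ((n - 1) choose (r - 1))"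
  shows "\<exists>x\<in>{1..n}. (2 * card (star n r x - F) + 1) * ((n - r) choose r)
           \<le> 18 * n ^ 7 * card (inner_pairs n r F)"
proof -
  define V N D E b g P :: real
    where "V = real (n choose r)" and "N = real ((n - 1) choose (r - 1))" and "D = real ((n - r) choose r)"
      and "E = real (card (inner_pairs n r F))" and "b = real (card bad)" and "g = real (card rough)"
      and "P = fact (n - 1)"
  have n1: "n \<ge> 1" using rn by simp
  have P0: "P > 0" by (simp add: P_def)
  have V0: "V > 0" and D0: "D > 0" using rn by (auto simp: V_def D_def)
  have N0: "N \<ge> 0" and E0: "E \<ge> 0" and g0: "g \<ge> 0" by (auto simp: N_def E_def g_def)
  have fact_n: "fact n = real n * P" using n1 by (simp add: P_def fact_reduce)
  have "real n * N = V * real r" using binomial_star unfolding V_def N_def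
    by (metis of_nat_mult)
  also have "\<dots> \<le> V * real n" using V0 rn by (intro mult_left_mono) auto
  finally have NV: "N \<le> V" using n1 by simp
  have n_ge1: "1 \<le> real n" using n1 by simp
  have a: "V * D * b \<le> (real n)\<^sup>2 * (E * (real n * P))"
  proof -
    have "real ((n choose r) * ((n - r) choose r) * card bad) \<le> real (n\<^sup>2 * (card (inner_pairs n r F) * fact n))"
      using card_bad_le by (rule of_nat_mono)
    then show ?thesis by (simp add: V_def D_def b_def E_def fact_n)
  qed
  have bb: "V * g + real n * (real n * P) \<le> (real n + 1) * (V * b)"
  proof -
    have "real ((n choose r) * card rough + n * fact n) \<le> real (Suc n * ((n choose r) * card bad))"
      using rough_bound[OF cF] by (rule of_nat_mono)
    then show ?thesis by (simp add: V_def g_def b_def fact_n algebra_simps)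
  qed
  have ab: "D * (V * g + real n * (real n * P)) \<le> 2 * real n ^ 4 * E * P"
  proof -
    have "D * (V * g + real n * (real n * P)) \<le> D * ((real n + 1) * (V * b))"
      using bb D0 by (intro mult_left_mono) auto
    also have "\<dots> = (real n + 1) * (V * D * b)" by (simp add: algebra_simps)
    also have "\<dots> \<le> (real n + 1) * ((real n)\<^sup>2 * (E * (real n * P)))"
      using a by (intro mult_left_mono) auto
    also have "\<dots> \<le> (2 * real n) * ((real n)\<^sup>2 * (E * (real n * P)))"
      using n_ge1 E0 P0 by (intro mult_right_mono) auto
    finally show ?thesis by (simp add: power_def numeral_eq_Suc algebra_simps)
  qed
  \<comment> \<open>This pays for the summand 1 in the symmetric difference; it rests on the surplus
    term of \<open>rough_bound\<close> and holds even when F contains a whole star.\<close>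
  have D_le: "D \<le> 2 * real n ^ 7 * E"
  proof -
    have "real n * (real n * P) \<ge> 1 * (1 * P)" using n_ge1 P0 by (intro mult_mono) auto
    moreover have "V * g \<ge> 0" using V0 g0 by simp
    ultimately have "D * P \<le> D * (V * g + real n * (real n * P))" using D0 by (intro mult_left_mono) auto
    also note ab
    finally have "D * P \<le> (2 * real n ^ 4 * E) * P" .
    then have "D \<le> 2 * real n ^ 4 * E" using P0 by simp
    also have "\<dots> \<le> 2 * real n ^ 7 * E"
      using n_ge1 E0 by (intro mult_right_mono mult_left_mono power_increasing) auto
    finally show ?thesis .
  qed
  have DVg: "D * V * g \<le> 2 * real n ^ 4 * E * P"
  proof -
    have "D * V * g \<le> D * (V * g + real n * (real n * P))" using D0 P0 by (simp add: distrib_left)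
    then show ?thesis using ab by linarith
  qed
  have "\<exists>x\<in>{1..n}. real (card (star n r x - F)) * D \<le> 8 * real n ^ 7 * E"
  proof (cases "2 * g \<ge> real n * P")
    \<comment> \<open>At least half of all permutations are rough, so E is at least of order V D /
      n^4. Any star will do, as its deficit is at most N.\<close>
    case True
    have "card (star n r 1 - F) \<le> card (star n r 1)"
      by (intro card_mono) (auto simp: finite_imp_finite_nsets)
    also have "\<dots> = (n - 1) choose (r - 1)" using card_nsets_containing[of "{1..n}" 1 r] n1 r1 by simp
    finally have "real (card (star n r 1 - F)) \<le> N" unfolding N_def by simp
    also note NV
    finally have sV: "real (card (star n r 1 - F)) * D \<le> V * D" using D0 by (intro mult_right_mono) auto
    have "V * D * P \<le> V * D * (2 * g)"
    proof -
      have "1 * P \<le> real n * P" using n_ge1 P0 by (intro mult_right_mono) auto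
      then show ?thesis using True V0 D0 by (intro mult_left_mono) auto
    qed
    also have "\<dots> \<le> (4 * real n ^ 4 * E) * P" using DVg by (simp add: algebra_simps)
    finally have "V * D \<le> 4 * real n ^ 4 * E" using P0 by simp
    also have "\<dots> \<le> 8 * real n ^ 7 * E"
      using n_ge1 E0 by (intro mult_right_mono mult_mono power_increasing) auto
    finally show ?thesis using sV n1 by (intro bexI[of _ 1]) auto
  next
    \<comment> \<open>Now some class holds at least 1 / (2 n) of the permutations with x at m.
      Dividing the product bound by its size gives w \<le> 4 n^3 g, and together with the n^4 in
      \<open>DVg\<close> this makes n^7.\<close>
    case False
    obtain m x where mx: "m \<in> {1..n}" "x \<in> {1..n}" "fact n \<le> card rough + n\<^sup>2 * card (nice_at m x)"
      using exists_large_nice_at by blast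
    define h w where "h = real (card (nice_at m x))"
      and "w = real (card ({\<pi>. \<pi> permutes {1..n} \<and> \<pi> m = x} - nice_at m x))"
    let ?s = "real (card (star n r x - F))"
    have w0: "w \<ge> 0" by (simp add: w_def)
    have "real (fact n) \<le> real (card rough + n\<^sup>2 * card (nice_at m x))" using mx(3) by (rule of_nat_mono)
    then have "real n * P \<le> g + (real n)\<^sup>2 * h" by (simp add: fact_n g_def h_def)
    then have h: "real n * P \<le> 2 * (real n)\<^sup>2 * h" using False by simp
    have "real (card (nice_at m x) * card ({\<pi>. \<pi> permutes {1..n} \<and> \<pi> m = x} - nice_at m x))
        \<le> real (fact (n - 1) * (2 * n\<^sup>2 * card rough))"
      using nice_at_product_bound[OF mx(1)] by (rule of_nat_mono)
    then have hw: "h * w \<le> P * (2 * (real n)\<^sup>2 * g)" by (simp add: h_def w_def P_def g_def)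
    have "real (card (star n r x - F) * fact (n - 1))
        \<le> real (((n - 1) choose (r - 1)) * card ({\<pi>. \<pi> permutes {1..n} \<and> \<pi> m = x} - nice_at m x))"
      using star_deficit_le[OF mx(1,2)] by (rule of_nat_mono)
    then have "?s * P \<le> N * w" unfolding P_def N_def w_def by (simp only: of_nat_mult of_nat_fact)
    also have "\<dots> \<le> V * w" using NV w0 by (intro mult_right_mono) auto
    finally have sw: "?s * P \<le> V * w" .
    have "(real n * P) * w \<le> (2 * (real n)\<^sup>2 * h) * w" using h w0 by (rule mult_right_mono)
    also have "\<dots> \<le> 2 * (real n)\<^sup>2 * (P * (2 * (real n)\<^sup>2 * g))"
      using mult_left_mono[OF hw, of "2 * (real n)\<^sup>2"] by (simp add: algebra_simps)
    finally have "(real n * P) * w \<le> (real n * P) * (4 * real n ^ 3 * g)"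
      by (simp add: power_def numeral_eq_Suc algebra_simps)
    moreover have "real n * P > 0" using n1 P0 by simp
    ultimately have w: "w \<le> 4 * real n ^ 3 * g" by (rule mult_left_le_imp_le)
    have "?s * D * P \<le> D * (V * w)" using mult_left_mono[OF sw, of D] D0 by (simp add: algebra_simps)
    also have "\<dots> \<le> D * (V * (4 * real n ^ 3 * g))"
      using w D0 V0 by (intro mult_left_mono) auto
    also have "\<dots> = 4 * real n ^ 3 * (D * V * g)" by simp
    also have "\<dots> \<le> 4 * real n ^ 3 * (2 * real n ^ 4 * E * P)" using DVg by (intro mult_left_mono) auto
    also have "\<dots> = (8 * real n ^ 7 * E) * P" by (simp add: power_def numeral_eq_Suc algebra_simps)
    finally have "?s * D \<le> 8 * real n ^ 7 * E" using P0 by simp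
    then show ?thesis using mx(2) by blast
  qed
  then obtain x where x: "x \<in> {1..n}" "real (card (star n r x - F)) * D \<le> 8 * real n ^ 7 * E" by blast
  have "(2 * real (card (star n r x - F)) + 1) * D \<le> 18 * real n ^ 7 * E"
    using x(2) D_le by (simp add: algebra_simps)
  then have "real ((2 * card (star n r x - F) + 1) * ((n - r) choose r)) \<le> real (18 * n ^ 7 * card (inner_pairs n r F))"
    unfolding D_def E_def by (simp only: of_nat_mult of_nat_add of_nat_power of_nat_numeral of_nat_1)
  then show ?thesis using x(1) of_nat_le_iff by blast
qed

end

section \<open>Random subgraphs and the union bound\<close>

lemma prob_random_edges_avoid:
  assumes E: "finite E" and T: "T \<subseteq> E" and p: "0 \<le> p" "p \<le> 1"
  shows "measure_pmf.prob (random_edges E p) {W. W \<inter> T = {}} = (1 - p) ^ card T"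
proof -
  let ?B = "\<lambda>e. if e \<in> T then {False} else UNIV"
  have "(\<lambda>f. {e \<in> E. f e}) -` {W. W \<inter> T = {}} = Pi E ?B"
    using T by (auto simp: Pi_iff split: if_splits)
  then have "measure_pmf.prob (random_edges E p) {W. W \<inter> T = {}}
      = measure_pmf.prob (Pi_pmf E False (\<lambda>_. bernoulli_pmf p)) (Pi E ?B)"
    by (simp add: random_edges_def measure_map_pmf)
  also have "\<dots> = (\<Prod>e\<in>E. measure_pmf.prob (bernoulli_pmf p) (?B e))"
    using E by (rule measure_Pi_pmf_Pi)
  also have "\<dots> = (\<Prod>e\<in>E. if e \<in> T then 1 - p else 1)"
    using p by (intro prod.cong refl) (auto simp: measure_pmf_single)
  also have "\<dots> = (\<Prod>e\<in>T. 1 - p)"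
    using E T by (subst prod.inter_restrict[symmetric]) (auto simp: Int_absorb1)
  finally show ?thesis by simp
qed

lemma set_pmf_random_edges: "set_pmf (random_edges E p) \<subseteq> Pow E"
  by (auto simp: random_edges_def)

lemma finite_kneser_verts: "finite (kneser_verts n r)"
  by (simp add: kneser_verts_def finite_imp_finite_nsets)

lemma finite_kneser_edges: "finite (kneser_edges n r)"
  by (rule finite_subset[of _ "Pow (kneser_verts n r)"])
     (auto simp: kneser_edges_def finite_kneser_verts)

definition inner_edges :: "nat \<Rightarrow> nat \<Rightarrow> nat set set \<Rightarrow> nat set set set" where
  "inner_edges n r F = {e \<in> kneser_edges n r. e \<subseteq> F}"

lemma indep_avoids_inner_edges:
  assumes "indep F W" shows "W \<inter> inner_edges n r F = {}"
proof (rule ccontr)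
  assume "W \<inter> inner_edges n r F \<noteq> {}"
  then obtain A B where "{A, B} \<in> W" "{A, B} \<subseteq> F" "A \<noteq> B"
    by (auto simp: inner_edges_def kneser_edges_def)
  then show False using assms by (auto simp: indep_def)
qed

lemma indep_iff_avoids_inner_edges:
  assumes "F \<subseteq> kneser_verts n r" "W \<subseteq> kneser_edges n r"
  shows "indep F W \<longleftrightarrow> W \<inter> inner_edges n r F = {}"
proof
  assume av: "W \<inter> inner_edges n r F = {}"
  show "indep F W"
    unfolding indep_def
  proof (intro ballI impI notI)
    fix A B assume "A \<in> F" "B \<in> F" "A \<noteq> B" "{A, B} \<in> W"
    then show False using av assms(2) by (auto simp: inner_edges_def)
  qed
qed (rule indep_avoids_inner_edges)

lemma prob_indep:
  assumes F: "F \<subseteq> kneser_verts n r" and p: "0 \<le> p" "p \<le> 1"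
  shows "measure_pmf.prob (random_kneser_edges p n r) {W. indep F W} = (1 - p) ^ card (inner_edges n r F)"
proof -
  let ?M = "random_kneser_edges p n r"
  \<comment> \<open>The two events agree only on the support: \<open>indep\<close> looks at every
    doubleton in W, \<open>inner_edges\<close> only at Kneser edges.\<close>
  have "{W. indep F W} \<inter> set_pmf ?M = {W. W \<inter> inner_edges n r F = {}} \<inter> set_pmf ?M"
    using indep_iff_avoids_inner_edges[OF F] set_pmf_random_edges[of "kneser_edges n r" p]
    by (auto simp: random_kneser_edges_def)
  then have "measure_pmf.prob ?M {W. indep F W} = measure_pmf.prob ?M {W. W \<inter> inner_edges n r F = {}}"
    by (metis measure_Int_set_pmf)
  also have "\<dots> = (1 - p) ^ card (inner_edges n r F)"
    unfolding random_kneser_edges_def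
    by (rule prob_random_edges_avoid[OF finite_kneser_edges _ p]) (auto simp: inner_edges_def)
  finally show ?thesis .
qed

text \<open>Each edge arises from at most two ordered pairs; for r \<ge> 1 disjoint r-sets are
  distinct, so every pair does give an edge.\<close>

lemma card_inner_pairs:
  assumes "1 \<le> r" "F \<subseteq> kneser_verts n r"
  shows "card (inner_pairs n r F) \<le> 2 * card (inner_edges n r F)"
proof -
  have fin: "finite (inner_edges n r F)" by (simp add: inner_edges_def finite_kneser_edges)
  have "inner_pairs n r F \<subseteq> (\<Union>e\<in>inner_edges n r F. {AB. {fst AB, snd AB} = e})"
  proof
    fix AB assume "AB \<in> inner_pairs n r F"
    then obtain A B where AB: "AB = (A, B)" "A \<in> nsets {1..n} r" "B \<in> nsets {1..n} r" "A \<inter> B = {}" "A \<in> F" "B \<in> F"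
      by (auto simp: inner_pairs_def disjoint_pairs_def)
    have "A \<noteq> B" using AB assms(1) by (auto simp: nsets_def)
    then have "{A, B} \<in> inner_edges n r F"
      using AB unfolding inner_edges_def kneser_edges_def kneser_verts_def by blast
    then show "AB \<in> (\<Union>e\<in>inner_edges n r F. {AB. {fst AB, snd AB} = e})" using AB by auto
  qed
  moreover have pair: "{AB. {fst AB, snd AB} = {A, B}} = {(A, B), (B, A)}" for A B :: "nat set"
    by (auto simp: doubleton_eq_iff)
  have c2: "finite {AB. {fst AB, snd AB} = e} \<and> card {AB. {fst AB, snd AB} = e} \<le> 2"
    if e: "e \<in> inner_edges n r F" for e
  proof -
    obtain A B where "e = {A, B}" using e by (auto simp: inner_edges_def kneser_edges_def)
    moreover have "card {(A, B), (B, A)} \<le> 2" by (cases "A = B") auto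
    ultimately show ?thesis unfolding \<open>e = {A, B}\<close> pair by blast
  qed
  ultimately have "card (inner_pairs n r F) \<le> card (\<Union>e\<in>inner_edges n r F. {AB. {fst AB, snd AB} = e})"
    using fin by (intro card_mono) auto
  also have "\<dots> \<le> (\<Sum>e\<in>inner_edges n r F. card {AB. {fst AB, snd AB} = e})" by (rule card_UN_le[OF fin])
  also have "\<dots> \<le> (\<Sum>e\<in>inner_edges n r F. 2)" using c2 by (intro sum_mono) auto
  finally show ?thesis by simp
qed

lemma card_star: "1 \<le> r \<Longrightarrow> x \<in> {1..n} \<Longrightarrow> card (star n r x) = (n - 1) choose (r - 1)"
  using card_nsets_containing[of "{1..n}" x r] by simp

lemma star_subset_verts: "star n r x \<subseteq> kneser_verts n r"
  by (auto simp: kneser_verts_def)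

lemma inner_edges_star: "inner_edges n r (star n r x) = {}"
  by (auto simp: inner_edges_def kneser_edges_def)

lemma independence_number_ge:
  assumes "S \<subseteq> kneser_verts n r" "indep S W"
  shows "card S \<le> independence_number (kneser_verts n r) W"
  unfolding independence_number_def using assms finite_kneser_verts[of n r]
  by (intro Max_ge) (auto simp: finite_subset)

lemma independence_number_attained:
  obtains S where "S \<subseteq> kneser_verts n r" "indep S W" "card S = independence_number (kneser_verts n r) W"
proof -
  have "independence_number (kneser_verts n r) W \<in> card ` {S. S \<subseteq> kneser_verts n r \<and> indep S W}"
    unfolding independence_number_def using finite_kneser_verts[of n r] by (intro Max_in) auto
  then show ?thesis using that by auto
qed

text \<open>Stars stay independent in every subgraph, so a wrong independence number is too large,
  and some independent set can be cut down to exactly N + 1 vertices.\<close>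

lemma prob_EKR_ge_sum:
  assumes r: "1 \<le> r" "1 \<le> n" and p: "0 \<le> p" "p \<le> 1"
  shows "1 - prob_EKR p n r \<le>
    (\<Sum>F | F \<subseteq> kneser_verts n r \<and> card F = Suc ((n - 1) choose (r - 1)). (1 - p) ^ card (inner_edges n r F))"
proof -
  let ?M = "random_kneser_edges p n r" and ?N = "(n - 1) choose (r - 1)"
  let ?X = "{W. independence_number (kneser_verts n r) W = ?N}"
  let ?Fs = "{F. F \<subseteq> kneser_verts n r \<and> card F = Suc ?N}"
  have finFs: "finite ?Fs" using finite_kneser_verts[of n r] by simp
  have "(UNIV - ?X) \<inter> set_pmf ?M \<subseteq> (\<Union>F\<in>?Fs. {W. indep F W})"
  proof
    fix W assume "W \<in> (UNIV - ?X) \<inter> set_pmf ?M"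
    then have W: "independence_number (kneser_verts n r) W \<noteq> ?N" "W \<subseteq> kneser_edges n r"
      using set_pmf_random_edges[of "kneser_edges n r" p] by (auto simp: random_kneser_edges_def)
    have "indep (star n r 1) W"
      using indep_iff_avoids_inner_edges[OF star_subset_verts W(2)] inner_edges_star by blast
    then have "?N \<le> independence_number (kneser_verts n r) W"
      using independence_number_ge[OF star_subset_verts] card_star[of r 1 n] r by fastforce
    then have ge: "Suc ?N \<le> independence_number (kneser_verts n r) W" using W(1) by simp
    obtain S where S: "S \<subseteq> kneser_verts n r" "indep S W" "card S = independence_number (kneser_verts n r) W"
      by (rule independence_number_attained)
    obtain F where F: "F \<subseteq> S" "card F = Suc ?N"
      using obtain_subset_with_card_n[of "Suc ?N" S] ge S(3) by metis
    then have "F \<in> ?Fs" "indep F W" using S smaller_indep by auto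
    then show "W \<in> (\<Union>F\<in>?Fs. {W. indep F W})" by blast
  qed
  then have "measure_pmf.prob ?M ((UNIV - ?X) \<inter> set_pmf ?M) \<le> measure_pmf.prob ?M (\<Union>F\<in>?Fs. {W. indep F W})"
    by (intro measure_pmf.finite_measure_mono) auto
  also have "\<dots> \<le> (\<Sum>F\<in>?Fs. measure_pmf.prob ?M {W. indep F W})"
    by (intro measure_pmf.finite_measure_subadditive_finite[OF finFs]) auto
  also have "\<dots> = (\<Sum>F\<in>?Fs. (1 - p) ^ card (inner_edges n r F))"
    using prob_indep[OF _ p] by (intro sum.cong) auto
  finally have "measure_pmf.prob ?M (UNIV - ?X) \<le> (\<Sum>F\<in>?Fs. (1 - p) ^ card (inner_edges n r F))"
    by (simp only: measure_Int_set_pmf)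
  moreover have "measure_pmf.prob ?M (UNIV - ?X) = 1 - measure_pmf.prob ?M ?X"
    using measure_pmf.prob_compl[of ?X ?M] by simp
  ultimately show ?thesis by (simp add: prob_EKR_def)
qed

lemma sum_power_card_Pow:
  fixes q :: real
  assumes "finite A"
  shows "(\<Sum>X\<in>Pow A. q ^ card X) = (1 + q) ^ card A"
  using prod_add[OF assms, of "\<lambda>_. q" "\<lambda>_. 1"] by (simp add: add.commute)

text \<open>Summing over the symmetric difference with the nearest star, instead of over the family itself,
  makes the union bound converge.\<close>

lemma prob_EKR_ge_union_bound:
  assumes r: "1 \<le> r" "1 \<le> n" and p: "0 \<le> p" "p \<le> 1" and K: "0 \<le> K"
    and super: "\<And>F. F \<subseteq> kneser_verts n r \<Longrightarrow> card F = Suc ((n - 1) choose (r - 1)) \<Longrightarrow>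
      \<exists>x\<in>{1..n}. real (2 * card (star n r x - F) + 1) * K \<le> real (card (inner_pairs n r F)) / 2"
  shows "1 - prob_EKR p n r \<le> real n * ((1 + exp (- (p * K))) ^ (n choose r) - 1)"
proof -
  define q where "q = exp (- (p * K))"
  have q0: "q > 0" by (simp add: q_def)
  let ?N = "(n - 1) choose (r - 1)"
  let ?Fs = "{F. F \<subseteq> kneser_verts n r \<and> card F = Suc ?N}"
  let ?V = "kneser_verts n r"
  have finV: "finite ?V" by (rule finite_kneser_verts)
  have finFs: "finite ?Fs" using finV by simp
  define sd where "sd x F = (star n r x - F) \<union> (F - star n r x)" for x F
  have fin_star: "finite (star n r x)" for x
    using finite_subset[OF star_subset_verts finV] .
  have card_sd: "card (sd x F) = 2 * card (star n r x - F) + 1" if "F \<in> ?Fs" "x \<in> {1..n}" for x F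
  proof -
    have finF: "finite F" using that finV finite_subset by auto
    have "card (star n r x) = card (star n r x \<inter> F) + card (star n r x - F)"
      using card_Int_Diff[OF fin_star] .
    moreover have "card F = card (F \<inter> star n r x) + card (F - star n r x)"
      using card_Int_Diff[OF finF] .
    moreover have "card (sd x F) = card (star n r x - F) + card (F - star n r x)"
      unfolding sd_def using finF fin_star by (intro card_Un_disjoint) auto
    moreover have "card (star n r x) = ?N" by (rule card_star) (use r that in auto)
    ultimately show ?thesis using that by (simp add: Int_commute)
  qed
  have term_le: "(1 - p) ^ card (inner_edges n r F) \<le> (\<Sum>x\<in>{1..n}. q ^ card (sd x F))" if F: "F \<in> ?Fs" for F
  proof -
    obtain x where x: "x \<in> {1..n}" "real (2 * card (star n r x - F) + 1) * K \<le> real (card (inner_pairs n r F)) / 2"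
      using super F by blast
    have "real (card (inner_pairs n r F)) / 2 \<le> real (card (inner_edges n r F))"
      using card_inner_pairs[OF r(1), of F n] F by simp
    then have e: "real (card (sd x F)) * K \<le> real (card (inner_edges n r F))"
      using x card_sd[OF F x(1)] by simp
    have "(1 - p) ^ card (inner_edges n r F) \<le> exp (- p) ^ card (inner_edges n r F)"
      using p exp_ge_add_one_self[of "- p"] by (intro power_mono) auto
    also have "\<dots> = exp (- (p * real (card (inner_edges n r F))))"
      by (simp add: exp_of_nat_mult[symmetric] mult.commute)
    also have "\<dots> \<le> exp (- (p * (real (card (sd x F)) * K)))"
      using mult_left_mono[OF e p(1)] by simp
    also have "\<dots> = q ^ card (sd x F)"
      by (simp add: q_def exp_of_nat_mult[symmetric] algebra_simps)
    \<comment> \<open>The nearest star depends on F; summing over all stars removes this dependence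
      and costs the factor n.\<close>
    also have "\<dots> \<le> (\<Sum>x\<in>{1..n}. q ^ card (sd x F))"
      using x(1) q0 by (intro member_le_sum) auto
    finally show ?thesis .
  qed
  have "1 - prob_EKR p n r \<le> (\<Sum>F\<in>?Fs. (1 - p) ^ card (inner_edges n r F))"
    using prob_EKR_ge_sum[OF r p] .
  also have "\<dots> \<le> (\<Sum>F\<in>?Fs. \<Sum>x\<in>{1..n}. q ^ card (sd x F))" by (intro sum_mono term_le)
  also have "\<dots> = (\<Sum>x\<in>{1..n}. \<Sum>F\<in>?Fs. q ^ card (sd x F))" by (rule sum.swap)
  also have "\<dots> \<le> (\<Sum>x\<in>{1..n}. (1 + q) ^ (n choose r) - 1)"
  proof (rule sum_mono)
    fix x assume x: "x \<in> {1..n}"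
    have inj: "inj_on (sd x) ?Fs" by (rule inj_onI) (auto simp: sd_def set_eq_iff)
    have "(\<Sum>F\<in>?Fs. q ^ card (sd x F)) = (\<Sum>C\<in>sd x ` ?Fs. q ^ card C)"
      using inj by (simp add: sum.reindex)
    \<comment> \<open>The symmetric difference has odd size, so the empty set is left out. This
      yields the subtraction of 1, without which the bound would exceed n.\<close>
    also have "\<dots> \<le> (\<Sum>C\<in>Pow ?V - {{}}. q ^ card C)"
    proof (rule sum_mono2)
      show "sd x ` ?Fs \<subseteq> Pow ?V - {{}}"
      proof (rule image_subsetI)
        fix F assume F: "F \<in> ?Fs"
        have "card (sd x F) \<noteq> 0" using card_sd[OF F x] by simp
        then have "sd x F \<noteq> {}" by auto
        moreover have "sd x F \<subseteq> ?V" using F star_subset_verts by (auto simp: sd_def)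
        ultimately show "sd x F \<in> Pow ?V - {{}}" by simp
      qed
    qed (use finV q0 in auto)
    also have "\<dots> = (\<Sum>C\<in>Pow ?V. q ^ card C) - 1"
      using finV by (subst sum_diff1) auto
    also have "\<dots> = (1 + q) ^ (n choose r) - 1"
      using sum_power_card_Pow[OF finV, of q] by (simp add: kneser_verts_def)
    finally show "(\<Sum>F\<in>?Fs. q ^ card (sd x F)) \<le> (1 + q) ^ (n choose r) - 1" .
  qed
  finally show ?thesis by (simp add: q_def)
qed

lemma prob_EKR_ge:
  assumes r: "1 \<le> r" "r < n" and p: "0 \<le> p" "p \<le> 1"
    and pK: "4 * ln (real (n choose r)) \<le> p * K" and K: "0 \<le> K"
    and super: "\<And>F. F \<subseteq> kneser_verts n r \<Longrightarrow> card F = Suc ((n - 1) choose (r - 1)) \<Longrightarrow>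
      \<exists>x\<in>{1..n}. real (2 * card (star n r x - F) + 1) * K \<le> real (card (inner_pairs n r F)) / 2"
  shows "1 - prob_EKR p n r \<le> 2 / real n"
proof -
  define q where "q = exp (- (p * K))"
  define V where "V = real (n choose r)"
  have n: "n \<ge> 1" using r by simp
  have "n choose 1 \<le> n choose r"
  proof (cases "2 * r \<le> n")
    case True then show ?thesis using r by (intro binomial_mono) auto
  next
    case False
    have "n choose 1 \<le> n choose (n - r)" using r False by (intro binomial_mono) auto
    then show ?thesis using r by (simp add: binomial_symmetric[of r n])
  qed
  then have Vn: "real n \<le> V" by (simp add: V_def)
  then have V1: "1 \<le> V" using n by linarith
  have "q \<le> exp (- (4 * ln V))" using pK by (simp add: q_def V_def)
  also have "\<dots> = 1 / V ^ 4"
  proof -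
    have "exp (4 * ln V) = exp (ln V) ^ 4" using exp_of_nat_mult[of 4 "ln V"] by simp
    then show ?thesis using V1 by (simp add: exp_minus field_simps)
  qed
  finally have q: "q \<le> 1 / V ^ 4" .
  have q0: "q > 0" by (simp add: q_def)
  have "V * q \<le> V * (1 / V ^ 4)" using q V1 by (intro mult_left_mono) auto
  also have "\<dots> = 1 / V ^ 3" using V1 by (simp add: power_def numeral_eq_Suc)
  finally have Vq: "V * q \<le> 1 / V ^ 3" .
  \<comment> \<open>Since n \<le> V, the power V^-2 turns the factor n of the union bound into 2 /
    n.\<close>
  have Vi: "1 / V ^ 3 \<le> 1 / V ^ 2" using V1 by (intro divide_left_mono power_increasing) auto
  have "1 / V ^ 2 \<le> 1" using V1 by simp
  then have Vq1: "V * q \<le> 1" using Vq Vi by linarith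
  have "(1 + q) ^ (n choose r) \<le> exp q ^ (n choose r)"
    using q0 by (intro power_mono) auto
  also have "\<dots> = exp (V * q)" by (simp add: V_def exp_of_nat_mult[symmetric])
  also have "\<dots> \<le> 1 + V * q + (V * q)\<^sup>2" using Vq1 q0 V1 by (intro exp_bound) auto
  also have "\<dots> \<le> 1 + 2 * (V * q)"
    using mult_right_mono[OF Vq1, of "V * q"] q0 V1 by (simp add: power2_eq_square)
  finally have "(1 + q) ^ (n choose r) - 1 \<le> 2 / V ^ 2" using Vq Vi by linarith
  then have "real n * ((1 + q) ^ (n choose r) - 1) \<le> real n * (2 / V ^ 2)" by (intro mult_left_mono) auto
  also have "\<dots> \<le> real n * (2 / real n ^ 2)"
    using Vn n by (intro mult_left_mono divide_left_mono power_mono) auto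
  also have "\<dots> = 2 / real n" using n by (simp add: power2_eq_square)
  finally show ?thesis
    using prob_EKR_ge_union_bound[OF r(1) n p K super] unfolding q_def by linarith
qed

section \<open>Supersaturation for small r\<close>

text \<open>Pascal's rule applied a times, each increment being bounded by the last. It serves to
  bound the number of members of a star that meet a given r-set.\<close>

lemma choose_add_le:
  "(m + a) choose Suc k \<le> (m choose Suc k) + a * ((m + a - 1) choose k)"
proof (induction a)
  case (Suc a)
  have "(m + a - 1) choose k \<le> (m + a) choose k" by (rule binomial_right_mono) simp
  then have "a * ((m + a - 1) choose k) \<le> a * ((m + a) choose k)" by simp
  with Suc.IH have "(m + a) choose Suc k \<le> (m choose Suc k) + a * ((m + a) choose k)" by linarith
  then show ?case by simp
qed simp

text \<open>For r small compared with n, a family with an element of large degree already has many edges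
  between its star part and the rest, and one without such an element is almost complete.\<close>

lemma Kneser_supersaturation_degree:
  assumes r: "1 \<le> r" "2 * r \<le> n"
    and F: "F \<subseteq> kneser_verts n r" "card F = Suc ((n - 1) choose (r - 1))"
    and close: "4 * r * (((n - 1) choose (r - 1)) - ((n - r - 1) choose (r - 1))) \<le> (n - 1) choose (r - 1)"
  shows "\<exists>x\<in>{1..n}. (2 * card (star n r x - F) + 1) * ((n - 1) choose (r - 1))
    \<le> 8 * r * card (inner_pairs n r F)"
proof -
  define N M where "N = (n - 1) choose (r - 1)" and "M = (n - r - 1) choose (r - 1)"
  define g where "g A = card {B \<in> F. A \<inter> B = {}}" for A
  define d where "d x = card (F \<inter> star n r x)" for x
  have finF: "finite F" using F(1) finite_kneser_verts finite_subset by blast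
  have Fn: "A \<in> nsets {1..n} r" if "A \<in> F" for A using that F(1) by (auto simp: kneser_verts_def)
  have fin_star: "finite (star n r x)" for x by (simp add: finite_imp_finite_nsets)
  have "inner_pairs n r F = (SIGMA A:F. {B \<in> F. A \<inter> B = {}})"
    using Fn by (auto simp: inner_pairs_def disjoint_pairs_def)
  then have E: "card (inner_pairs n r F) = (\<Sum>A\<in>F. g A)" using finF by (simp add: g_def)
  have s: "card (star n r x - F) + d x = N" if "x \<in> {1..n}" for x
    using card_Int_Diff[OF fin_star[of x], of F] card_star[OF r(1) that]
    by (simp add: d_def N_def Int_commute)
  show ?thesis
  proof (cases "\<forall>x\<in>{1..n}. 2 * r * d x \<le> N")
    case True
    \<comment> \<open>With all degrees at most N / (2 r), the r elements of A account for at most N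
      / 2 members of F, so A is disjoint from at least half of F.\<close>
    have g: "N \<le> 2 * g A" if A: "A \<in> F" for A
    proof -
      have Ap: "finite A" "A \<subseteq> {1..n}" "card A = r" using Fn[OF A] by (auto simp: nsets_def)
      have "F \<subseteq> {B \<in> F. A \<inter> B = {}} \<union> (\<Union>y\<in>A. F \<inter> star n r y)" using Fn by auto
      then have "card F \<le> card ({B \<in> F. A \<inter> B = {}} \<union> (\<Union>y\<in>A. F \<inter> star n r y))"
        using finF Ap by (intro card_mono) auto
      also have "\<dots> \<le> g A + card (\<Union>y\<in>A. F \<inter> star n r y)" unfolding g_def by (rule card_Un_le)
      also have "card (\<Union>y\<in>A. F \<inter> star n r y) \<le> (\<Sum>y\<in>A. d y)"
        unfolding d_def by (rule card_UN_le[OF Ap(1)])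
      finally have 1: "Suc N \<le> g A + (\<Sum>y\<in>A. d y)" using F(2) by (simp add: N_def)
      have "r * (2 * (\<Sum>y\<in>A. d y)) = (\<Sum>y\<in>A. 2 * r * d y)"
        by (simp add: sum_distrib_left[symmetric])
      also have "\<dots> \<le> (\<Sum>y\<in>A. N)" using True Ap by (intro sum_mono) auto
      also have "\<dots> = r * N" using Ap by simp
      finally have "2 * (\<Sum>y\<in>A. d y) \<le> N" using r by simp
      then show ?thesis using 1 by simp
    qed
    have "Suc N * N = (\<Sum>A\<in>F. N)" using F(2) by (simp add: N_def)
    also have "\<dots> \<le> (\<Sum>A\<in>F. 2 * g A)" by (intro sum_mono g)
    also have "\<dots> = 2 * card (inner_pairs n r F)" by (simp add: E sum_distrib_left)
    finally have E2: "Suc N * N \<le> 2 * card (inner_pairs n r F)" .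
    have "card (star n r 1 - F) \<le> N" using s[of 1] r by simp
    then have "(2 * card (star n r 1 - F) + 1) * N \<le> (2 * Suc N) * N" by (intro mult_right_mono) auto
    also have "\<dots> \<le> 4 * card (inner_pairs n r F)" using E2 by simp
    also have "\<dots> \<le> 8 * r * card (inner_pairs n r F)" using r by (intro mult_right_mono) auto
    finally show ?thesis using r unfolding N_def by (intro bexI[of _ 1]) auto
  next
    case False
    then obtain x where x: "x \<in> {1..n}" "2 * r * d x > N" by force
    \<comment> \<open>M members of the star at x are disjoint from A, so at most N - M meet it. By
      \<open>close\<close> that is at most N / (4 r), whereas F holds more than N / (2 r) members of
      the star; at least N / (4 r) of those avoid A.\<close>
    have g: "N \<le> 4 * r * g A" if A: "A \<in> F - star n r x" for A
    proof -
      let ?Dis = "{B \<in> star n r x. A \<inter> B = {}}"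
      have Ap: "finite A" "A \<subseteq> {1..n}" "card A = r" "x \<notin> A" using Fn[of A] A by (auto simp: nsets_def)
      have "?Dis = {B \<in> nsets ({1..n} - A) r. x \<in> B}" by (auto simp: nsets_def)
      then have "card ?Dis = (card ({1..n} - A) - 1) choose (r - 1)"
        using card_nsets_containing[of "{1..n} - A" x r] x Ap r by simp
      then have Dis: "card ?Dis = M" using Ap by (simp add: card_Diff_subset M_def)
      have finDis: "finite ?Dis" by (rule finite_subset[OF _ fin_star[of x]]) auto
      have "card (F \<inter> star n r x) + card ?Dis = card ((F \<inter> star n r x) \<union> ?Dis) + card ((F \<inter> star n r x) \<inter> ?Dis)"
        using finF finDis by (intro card_Un_Int) simp_all
      moreover have "card ((F \<inter> star n r x) \<union> ?Dis) \<le> card (star n r x)"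
        by (rule card_mono[OF fin_star]) auto
      moreover have "card ((F \<inter> star n r x) \<inter> ?Dis) \<le> g A"
        unfolding g_def using finF by (intro card_mono) auto
      ultimately have "d x + M \<le> N + g A"
        using Dis card_star[OF r(1) x(1)] by (simp add: d_def N_def)
      then have "d x \<le> (N - M) + g A" by simp
      then have "4 * r * d x \<le> 4 * r * ((N - M) + g A)" by (rule mult_le_mono2)
      then have "4 * r * d x \<le> 4 * r * (N - M) + 4 * r * g A" by (simp only: distrib_left)
      moreover have "4 * r * (N - M) \<le> N" using close by (simp add: N_def M_def)
      ultimately show ?thesis using x(2) by linarith
    qed
    have "card F = d x + card (F - star n r x)" using card_Int_Diff[OF finF] by (simp add: d_def)
    \<comment> \<open>F has one vertex more than the star, so F - star exceeds the deficit by 1,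
      which is what the summand 1 in the symmetric difference requires.\<close>
    then have cF: "card (F - star n r x) = card (star n r x - F) + 1"
      using s[OF x(1)] F(2) by (simp add: N_def)
    have "(card (star n r x - F) + 1) * N = (\<Sum>A\<in>F - star n r x. N)" by (simp only: sum_constant cF of_nat_id)
    also have "\<dots> \<le> (\<Sum>A\<in>F - star n r x. 4 * r * g A)" by (intro sum_mono g)
    also have "\<dots> \<le> (\<Sum>A\<in>F. 4 * r * g A)" using finF by (intro sum_mono2) auto
    also have "\<dots> = 4 * r * card (inner_pairs n r F)" by (simp add: E sum_distrib_left)
    finally have "(card (star n r x - F) + 1) * N \<le> 4 * r * card (inner_pairs n r F)" .
    then have "(2 * card (star n r x - F) + 1) * N \<le> 8 * r * card (inner_pairs n r F)" by simp
    then show ?thesis using x(1) unfolding N_def by blast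
  qed
qed

text \<open>N - M is at most r times (n - 2 choose r - 2), which is N r (r - 1) / (n - 1).
  Multiplied by 4 r this stays below N as long as 4 r^3 \<le> n - 1. For r = 1 both binomials equal
  1.\<close>

lemma choose_close:
  assumes "1 \<le> r" "4 * r ^ 3 < n"
  shows "4 * r * (((n - 1) choose (r - 1)) - ((n - r - 1) choose (r - 1))) \<le> (n - 1) choose (r - 1)"
proof (cases "r = 1")
  case False
  define k where "k = r - 2"
  have k: "r = Suc (Suc k)" using False assms(1) by (simp add: k_def)
  have "r * 1 \<le> r * r ^ 2" using assms by (intro mult_le_mono2) simp
  also have "\<dots> = r ^ 3" by (simp add: power2_eq_square power3_eq_cube)
  finally have rn: "4 * r < n" using assms(2) by linarith
  let ?N = "(n - 1) choose (r - 1)" and ?M = "(n - r - 1) choose (r - 1)"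
  have "n - r - 1 + r = n - 1" "n - 1 - 1 = n - 2" "r - 1 = Suc k" using rn k by auto
  then have "?N \<le> ?M + r * ((n - 2) choose k)"
    using choose_add_le[where m="n - r - 1" and a=r and k=k] by (simp only:)
  then have 1: "?N - ?M \<le> r * ((n - 2) choose k)" by linarith
  have "Suc (n - 2) * ((n - 2) choose k) = (Suc (n - 2) choose Suc k) * Suc k"
    by (rule Suc_times_binomial_eq)
  moreover have "Suc (n - 2) = n - 1" using rn k by simp
  ultimately have 2: "(n - 1) * ((n - 2) choose k) = ?N * (r - 1)" using k by simp
  have "(n - 1) * (4 * r * (?N - ?M)) \<le> (n - 1) * (4 * r * (r * ((n - 2) choose k)))"
    using 1 by (intro mult_le_mono2)
  also have "\<dots> = 4 * r * r * ((n - 1) * ((n - 2) choose k))" by simp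
  also have "\<dots> = 4 * r * r * (r - 1) * ?N" by (simp only: 2) simp
  also have "\<dots> \<le> 4 * r * r * r * ?N" by (intro mult_right_mono mult_left_mono) auto
  also have "\<dots> \<le> (n - 1) * ?N" using assms(2) by (intro mult_right_mono) (auto simp: power3_eq_cube ac_simps)
  finally show ?thesis by (rule mult_left_le_imp_le) (use rn k in simp)
qed simp

section \<open>The lower range, and the case p = 1\<close>

lemma prob_EKR_le:
  assumes r: "1 \<le> r" "r < n" and p: "0 \<le> p" "p \<le> 1"
  shows "prob_EKR p n r \<le> p * real ((n - 1) choose (r - 1))"
proof -
  let ?M = "random_kneser_edges p n r" and ?N = "(n - 1) choose (r - 1)"
  define A where "A = {2..r + 1}"
  have A: "A \<in> kneser_verts n r" "1 \<notin> A" using r by (auto simp: kneser_verts_def nsets_def A_def)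
  define F where "F = insert A (star n r 1)"
  have F: "F \<subseteq> kneser_verts n r" using A star_subset_verts by (simp add: F_def)
  have fin_star: "finite (star n r 1)" by (simp add: finite_imp_finite_nsets)
  have star: "card (star n r 1) = ?N" by (rule card_star) (use r in auto)
  have cF: "card F = Suc ?N" using A fin_star star by (simp add: F_def)
  \<comment> \<open>Members of the star pairwise share the element 1, so every edge inside F uses
    A.\<close>
  have "inner_edges n r F \<subseteq> (\<lambda>B. {A, B}) ` star n r 1"
  proof
    fix e assume "e \<in> inner_edges n r F"
    then obtain B C where e: "e = {B, C}" "B \<in> F" "C \<in> F" "B \<noteq> C" "B \<inter> C = {}"
      by (auto simp: inner_edges_def kneser_edges_def)
    then have "B = A \<and> C \<in> star n r 1 \<or> C = A \<and> B \<in> star n r 1" by (auto simp: F_def)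
    then show "e \<in> (\<lambda>B. {A, B}) ` star n r 1" using e(1) by (auto simp: insert_commute)
  qed
  then have "card (inner_edges n r F) \<le> card ((\<lambda>B. {A, B}) ` star n r 1)"
    using fin_star by (intro card_mono) auto
  also have "\<dots> \<le> ?N" using card_image_le[OF fin_star] star by metis
  finally have e: "card (inner_edges n r F) \<le> ?N" .
  have "{W. independence_number (kneser_verts n r) W = ?N} \<subseteq> UNIV - {W. indep F W}"
    using independence_number_ge[OF F] cF by force
  then have "prob_EKR p n r \<le> measure_pmf.prob ?M (UNIV - {W. indep F W})"
    unfolding prob_EKR_def by (intro measure_pmf.finite_measure_mono) auto
  also have "\<dots> = 1 - (1 - p) ^ card (inner_edges n r F)"
    using measure_pmf.prob_compl[of "{W. indep F W}" ?M] prob_indep[OF F p] by simp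
  also have "\<dots> \<le> p * real (card (inner_edges n r F))"
    using Bernoulli_inequality[of "- p" "card (inner_edges n r F)"] p by (simp add: mult.commute)
  also have "\<dots> \<le> p * real ?N" using e p by (intro mult_left_mono) auto
  finally show ?thesis .
qed

text \<open>Supersaturation with positive K forces at least one edge into every family of N + 1
  vertices, and at p = 1 all edges are kept. It handles r = 1, where K is a constant while ln V
  grows.\<close>

lemma prob_EKR_1:
  assumes r: "1 \<le> r" "1 \<le> n" and K: "0 < K"
    and super: "\<And>F. F \<subseteq> kneser_verts n r \<Longrightarrow> card F = Suc ((n - 1) choose (r - 1)) \<Longrightarrow>
      \<exists>x\<in>{1..n}. real (2 * card (star n r x - F) + 1) * K \<le> real (card (inner_pairs n r F)) / 2"
  shows "1 - prob_EKR 1 n r \<le> 0"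
proof -
  have "(1 - 1 :: real) ^ card (inner_edges n r F) = 0"
    if F: "F \<subseteq> kneser_verts n r" "card F = Suc ((n - 1) choose (r - 1))" for F
  proof -
    obtain x where "real (2 * card (star n r x - F) + 1) * K \<le> real (card (inner_pairs n r F)) / 2"
      using super[OF F] by blast
    moreover have "real (2 * card (star n r x - F) + 1) * K > 0" using K by simp
    ultimately have "card (inner_pairs n r F) > 0" by linarith
    then have "card (inner_edges n r F) > 0" using card_inner_pairs[OF r(1) F(1)] by linarith
    then show ?thesis by simp
  qed
  then have "(\<Sum>F | F \<subseteq> kneser_verts n r \<and> card F = Suc ((n - 1) choose (r - 1)).
      (1 - 1 :: real) ^ card (inner_edges n r F)) = 0"
    by (intro sum.neutral) blast
  then show ?thesis using prob_EKR_ge_sum[OF r, of 1] by simp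
qed

section \<open>Binomial estimates\<close>

text \<open>One term of the expansion of (1 + x)^n is kept, at x = r / n, and 1 + x is bounded by
  exp x.\<close>

lemma choose_le_exp:
  assumes "1 \<le> r" "r \<le> n"
  shows "real (n choose r) \<le> exp (real r) * (real n / real r) ^ r"
proof -
  define x where "x = real r / real n"
  have x: "x > 0" using assms by (simp add: x_def)
  have "real (n choose r) * x ^ r \<le> (\<Sum>k\<le>n. real (n choose k) * x ^ k)"
    using assms x by (intro member_le_sum[of r "{..n}" "\<lambda>k. real (n choose k) * x ^ k"]) auto
  also have "\<dots> = (x + 1) ^ n" by (simp add: binomial_ring)
  also have "\<dots> \<le> exp x ^ n" using x exp_ge_add_one_self[of x] by (intro power_mono) (simp_all add: add.commute)
  also have "\<dots> = exp (real r)" using assms by (simp add: x_def exp_of_nat_mult[symmetric])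
  finally have "real (n choose r) \<le> exp (real r) / x ^ r" using x by (simp add: field_simps)
  then show ?thesis using assms by (simp add: x_def field_simps)
qed

text \<open>With y = n / r, the two sides are compared through y powr (\<theta> * r): the choice of \<theta> gives
  y powr \<theta> <= y - 1 for y >= y0, and n choose r <= (e * y) ^ r <= y ^ (3 * r).\<close>

lemma choose_ge_powr_choose:
  fixes y0 \<theta> :: real
  assumes r: "1 \<le> r" and y0: "2 < y0" "y0 * real r \<le> real n" and \<theta>: "\<theta> = ln (y0 - 1) / ln y0"
  shows "real ((n - r) choose r) \<ge> real (n choose r) powr (\<theta> / 3)"
proof -
  define y where "y = real n / real r"
  have r0: "real r > 0" using r by simp
  have yy: "y0 \<le> y" using y0 r0 by (simp add: y_def field_simps)
  have "2 * real r \<le> y0 * real r" using y0 by (intro mult_right_mono) auto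
  then have rn: "2 * r \<le> n" using y0 by linarith
  have \<theta>0: "0 < \<theta>" "\<theta> < 1" using y0 by (auto simp: \<theta>)
  have "y0 powr \<theta> = y0 - 1" using y0 by (simp add: \<theta> powr_def)
  \<comment> \<open>At y0 the two sides agree by the choice of \<theta>. Scaling by t multiplies the
    left side by t powr \<theta>, at most t, and (y0 - 1) t = y - t \<le> y - 1.\<close>
  define t where "t = y / y0"
  have t: "t \<ge> 1" "y = y0 * t" using yy y0 by (auto simp: t_def)
  have "y powr \<theta> = (y0 - 1) * t powr \<theta>"
    using t y0 \<open>y0 powr \<theta> = y0 - 1\<close> by (simp add: powr_mult)
  also have "\<dots> \<le> (y0 - 1) * t powr 1" using t \<theta>0 y0 by (intro mult_left_mono powr_mono) auto
  also have "\<dots> \<le> y - 1" using t y0 by (simp add: algebra_simps)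
  finally have y1: "y powr \<theta> \<le> y - 1" .
  have "exp (1::real) \<le> 2 * 2" using exp_le by linarith
  also have "\<dots> \<le> y * y" using yy y0 by (intro mult_mono) auto
  finally have ey: "exp 1 \<le> y * y" .
  have "exp (real r) = exp 1 ^ r" by (simp add: exp_of_nat_mult[symmetric])
  also have "\<dots> \<le> (y * y) ^ r" using ey by (intro power_mono) auto
  finally have er: "exp (real r) \<le> (y * y) ^ r" .
  have "real (n choose r) \<le> exp (real r) * y ^ r" using choose_le_exp[of r n] r rn by (simp add: y_def)
  also have "\<dots> \<le> (y * y) ^ r * y ^ r" using er yy y0 by (intro mult_right_mono) auto
  also have "\<dots> = y powr (3 * real r)"
  proof -
    have "(y * y) ^ r * y ^ r = (y ^ 3) ^ r" by (simp add: power_mult_distrib power3_eq_cube)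
    also have "\<dots> = y ^ (3 * r)" by (simp add: power_mult)
    also have "\<dots> = y powr real (3 * r)" using yy y0 by (intro powr_realpow[symmetric]) auto
    finally show ?thesis by simp
  qed
  finally have "real (n choose r) powr (\<theta> / 3) \<le> (y powr (3 * real r)) powr (\<theta> / 3)"
    using \<theta>0 by (intro powr_mono2) auto
  also have "\<dots> = (y powr \<theta>) powr real r" by (simp add: powr_powr mult.commute)
  also have "\<dots> = (y powr \<theta>) ^ r" using yy y0 by (intro powr_realpow) auto
  also have "\<dots> \<le> (y - 1) ^ r" using y1 by (intro power_mono) auto
  also have "\<dots> = (real (n - r) / real r) ^ r" using rn r0 by (simp add: y_def of_nat_diff field_simps)
  also have "\<dots> \<le> real ((n - r) choose r)" by (rule binomial_ge_n_over_k_pow_k) (use rn in simp)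
  finally show ?thesis .
qed

text \<open>Makes N tend to infinity with n for every choice of r \<ge> 2, which both the lower
  range and p = 1/2 rely on.\<close>

lemma choose_pred_ge:
  assumes "2 \<le> r" "r < n"
  shows "n - 1 \<le> (n - 1) choose (r - 1)"
proof (cases "2 * (r - 1) \<le> n - 1")
  case True
  then have "(n - 1) choose 1 \<le> (n - 1) choose (r - 1)" using assms by (intro binomial_mono) auto
  then show ?thesis by simp
next
  case False
  then have "(n - 1) choose 1 \<le> (n - 1) choose (n - 1 - (r - 1))" using assms by (intro binomial_mono) auto
  also have "\<dots> = (n - 1) choose (r - 1)"
    by (rule binomial_symmetric[symmetric]) (use assms in simp)
  finally show ?thesis by simp
qed

lemma choose_pred_le: "1 \<le> r \<Longrightarrow> r \<le> n \<Longrightarrow> (n - 1) choose (r - 1) \<le> n choose r"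
  using binomial_Suc_Suc[of "n - 1" "r - 1"] by simp

section \<open>Choice of the exponent in the upper range\<close>

lemma Kneser_supersaturation_small:
  assumes r: "1 \<le> r" "2 * r \<le> n" "4 * r ^ 3 < n"
    and F: "F \<subseteq> kneser_verts n r" "card F = Suc ((n - 1) choose (r - 1))"
  shows "\<exists>x\<in>{1..n}. real (2 * card (star n r x - F) + 1) * (real ((n - 1) choose (r - 1)) / (16 * real r))
      \<le> real (card (inner_pairs n r F)) / 2"
proof -
  obtain x where x: "x \<in> {1..n}"
    "(2 * card (star n r x - F) + 1) * ((n - 1) choose (r - 1)) \<le> 8 * r * card (inner_pairs n r F)"
    using Kneser_supersaturation_degree[OF r(1,2) F choose_close[OF r(1,3)]] by blast
  have "real ((2 * card (star n r x - F) + 1) * ((n - 1) choose (r - 1))) \<le> real (8 * r * card (inner_pairs n r F))"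
    using x(2) by (rule of_nat_mono)
  then have "real (2 * card (star n r x - F) + 1) * real ((n - 1) choose (r - 1))
      \<le> 8 * real r * real (card (inner_pairs n r F))"
    by (simp only: of_nat_mult of_nat_numeral)
  then have "real (2 * card (star n r x - F) + 1) * (real ((n - 1) choose (r - 1)) / (16 * real r))
      \<le> real (card (inner_pairs n r F)) / 2"
    using r(1) by (simp add: divide_le_eq ac_simps)
  then show ?thesis using x(1) by blast
qed

lemma Kneser_supersaturation_large:
  assumes r: "1 \<le> r" "2 * r < n"
    and F: "F \<subseteq> kneser_verts n r" "card F = Suc ((n - 1) choose (r - 1))"
  shows "\<exists>x\<in>{1..n}. real (2 * card (star n r x - F) + 1) * (real ((n - r) choose r) / (36 * real n ^ 7))
      \<le> real (card (inner_pairs n r F)) / 2"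
proof -
  obtain x where x: "x \<in> {1..n}"
    "(2 * card (star n r x - F) + 1) * ((n - r) choose r) \<le> 18 * n ^ 7 * card (inner_pairs n r F)"
    using Kneser_supersaturation_circle[OF r F(1)[unfolded kneser_verts_def] F(2)] by blast
  have "real ((2 * card (star n r x - F) + 1) * ((n - r) choose r)) \<le> real (18 * n ^ 7 * card (inner_pairs n r F))"
    using x(2) by (rule of_nat_mono)
  then have "real (2 * card (star n r x - F) + 1) * real ((n - r) choose r)
      \<le> 18 * real n ^ 7 * real (card (inner_pairs n r F))"
    by (simp only: of_nat_mult of_nat_numeral of_nat_power)
  then have "real (2 * card (star n r x - F) + 1) * (real ((n - r) choose r) / (36 * real n ^ 7))
      \<le> real (card (inner_pairs n r F)) / 2"
    using r by (simp add: divide_le_eq ac_simps)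
  then show ?thesis using x(1) by blast
qed

text \<open>The quantifiers over r and p stand inside \<open>eventually\<close>, so the estimate is
  uniform and applies to sequences that move between the two regimes of r.\<close>

lemma prob_EKR_eventually_ge:
  fixes \<epsilon> :: real
  assumes "\<epsilon> > 0"
  obtains c where "0 < c" "c < 1"
    "\<forall>\<^sub>F n in sequentially. \<forall>r p. 1 \<le> r \<longrightarrow> real r \<le> (1/2 - \<epsilon>) * real n \<longrightarrow> 0 \<le> p \<longrightarrow> p \<le> 1 \<longrightarrow>
       p \<ge> real ((n - 1) choose (r - 1)) powr (- c) \<longrightarrow> 1 - prob_EKR p n r \<le> 2 / real n"
proof -
  \<comment> \<open>The cap 1/4 keeps 1/2 - e positive, so that y0, the resulting lower bound for n
    / r, is well defined and greater than 2.\<close>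
  define e where "e = min \<epsilon> (1/4)"
  have e: "0 < e" "e \<le> 1/4" "e \<le> \<epsilon>" using assms by (auto simp: e_def)
  define y0 where "y0 = 1 / (1/2 - e)"
  have y0: "2 < y0" using e by (simp add: y0_def less_divide_eq)
  define \<theta> where "\<theta> = ln (y0 - 1) / ln y0"
  have \<theta>: "0 < \<theta>" "\<theta> < 1" using y0 by (auto simp: \<theta>_def)
  \<comment> \<open>Half of the exponent in V powr (\<theta> / 3) \<le> D, so that p D is still at
    least V powr (\<theta> / 6).\<close>
  define c where "c = \<theta> / 6"
  have c: "0 < c" "c \<le> 1/2" using \<theta> by (auto simp: c_def)
  \<comment> \<open>With 54 = 6 * 9, the exponent R \<theta> / 6 is at least 9: eight powers of n
    are to be beaten, and the ninth absorbs the constant 144 R^9.\<close>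
  obtain R :: nat where R0: "max 2 (54 / \<theta>) \<le> real R" using real_arch_simple by blast
  then have R: "2 \<le> R" "54 \<le> \<theta> * real R" using \<theta> by (auto simp: divide_le_eq mult.commute)
  \<comment> \<open>For r < R: 64 is the 4 of 4 ln V times the 16 in K = N / (16 r), and the two
    factors R bound r and ln V / ln n.\<close>
  have "\<forall>\<^sub>F n in sequentially. sqrt (real n - 1) \<ge> (64 * real R ^ 2) * ln (real n)"
  proof -
    have "0 < 64 * real R ^ 2" using R by simp
    then show ?thesis by real_asymp
  qed
  moreover have "\<forall>\<^sub>F n in sequentially. n > 4 * R ^ 3 + 144 * R ^ 9 + 2" by (rule eventually_gt_at_top)
  ultimately have "\<forall>\<^sub>F n in sequentially. \<forall>r p. 1 \<le> r \<longrightarrow> real r \<le> (1/2 - \<epsilon>) * real n \<longrightarrow> 0 \<le> p \<longrightarrow> p \<le> 1 \<longrightarrow>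
       p \<ge> real ((n - 1) choose (r - 1)) powr (- c) \<longrightarrow> 1 - prob_EKR p n r \<le> 2 / real n"
  proof eventually_elim
    case (elim n)
    show ?case
    proof (intro allI impI)
      fix r :: nat and p :: real
      assume r: "1 \<le> r" "real r \<le> (1/2 - \<epsilon>) * real n" and p: "0 \<le> p" "p \<le> 1"
        and pN: "p \<ge> real ((n - 1) choose (r - 1)) powr (- c)"
      define N V where "N = real ((n - 1) choose (r - 1))" and "V = real (n choose r)"
      have "(1/2 - \<epsilon>) * real n \<le> (1/2 - e) * real n" using e by (intro mult_right_mono) auto
      then have yr: "y0 * real r \<le> real n" using r(2) e by (simp add: y0_def divide_le_eq mult.commute)
      have "2 * real r < y0 * real r" using y0 r by (intro mult_strict_right_mono) auto
      then have rn: "2 * r < n" using yr by linarith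
      have "0 < (n - 1) choose (r - 1)" using rn by simp
      then have N1: "1 \<le> N" unfolding N_def by linarith
      have NV: "N \<le> V" using choose_pred_le[OF r(1), of n] rn by (simp add: N_def V_def)
      have n2: "real n > 2" using elim(2) by linarith
      show "1 - prob_EKR p n r \<le> 2 / real n"
      proof (cases "r < R")
        case True
        have "r ^ 3 \<le> R ^ 3" using True by (intro power_mono) auto
        then have r3: "4 * r ^ 3 < n" using elim(2) by linarith
        have rn': "2 * r \<le> n" using rn by simp
        note super = Kneser_supersaturation_small[OF r(1) rn' r3]
        show ?thesis
        proof (cases "r = 1")
          case True
          then have "p = 1" using pN p by simp
          moreover have "1 - prob_EKR 1 n r \<le> 0"
            by (rule prob_EKR_1[OF r(1) _ _ super]) (use N1 r rn in \<open>auto simp: N_def\<close>)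
          moreover have "0 \<le> 2 / real n" by simp
          ultimately show ?thesis by (metis order_trans)
        next
          case False
          then have r2: "2 \<le> r" using r by simp
          have pK: "4 * ln V \<le> p * (N / (16 * real r))"
          proof -
            have "n choose r \<le> n ^ r" using rn by (intro binomial_le_pow) simp
            then have "real (n choose r) \<le> real (n ^ r)" by (rule of_nat_mono)
            then have "V \<le> real n ^ r" by (simp add: V_def)
            then have "ln V \<le> ln (real n ^ r)" using N1 NV by (intro ln_mono) auto
            also have "\<dots> = real r * ln (real n)" using n2 by (simp add: ln_realpow)
            also have "\<dots> \<le> real R * ln (real n)" using True n2 by (intro mult_right_mono) auto
            finally have lnV: "ln V \<le> real R * ln (real n)" .
            have "real (n - 1) \<le> real ((n - 1) choose (r - 1))"
              using choose_pred_ge[OF r2, of n] rn by (intro of_nat_mono) simp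
            then have nN: "real n - 1 \<le> N" using rn by (simp add: N_def of_nat_diff)
            have "64 * real R ^ 2 * ln (real n) \<le> sqrt (real n - 1)" using elim(1) .
            also have "\<dots> \<le> sqrt N" using nN by simp
            also have "\<dots> = N powr (1/2)" using N1 by (simp add: powr_half_sqrt)
            \<comment> \<open>Because c \<le> 1/2, the product p N keeps at least the square root of
              N, which beats the logarithm.\<close>
            also have "\<dots> \<le> N powr (1 + - c)" using c N1 by (intro powr_mono) auto
            also have "\<dots> = N * N powr (- c)" using N1 by (subst powr_add) simp
            also have "\<dots> \<le> N * p" using pN N1 by (intro mult_left_mono) (auto simp: N_def)
            finally have big: "64 * real R ^ 2 * ln (real n) \<le> p * N" by (simp add: mult.commute)
            have "4 * ln V * (16 * real r) \<le> 4 * (real R * ln (real n)) * (16 * real R)"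
              using lnV True n2 R N1 NV by (intro mult_mono) auto
            also have "\<dots> = 64 * real R ^ 2 * ln (real n)" by (simp add: power2_eq_square)
            also note big
            finally show ?thesis using r by (simp add: le_divide_eq)
          qed
          show ?thesis
            by (rule prob_EKR_ge[OF r(1) _ p pK[unfolded V_def N_def] _ super]) (use rn in auto)
        qed
      next
        case False
        define D where "D = real ((n - r) choose r)"
        have D: "V powr (\<theta> / 3) \<le> D"
          using choose_ge_powr_choose[OF r(1) y0 yr \<theta>_def] by (simp add: V_def D_def)
        have V1: "1 \<le> V" using N1 NV by simp
        have n0: "real n > 0" using n2 by simp
        have R9: "144 * real R ^ 9 \<le> real n"
        proof -
          have "144 * R ^ 9 \<le> n" using elim(2) by linarith
          then have "real (144 * R ^ 9) \<le> real n" by (rule of_nat_mono)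
          then show ?thesis by simp
        qed
        have "R \<le> n" using False rn by simp
        then have nR: "real n / real R \<ge> 1" using R by (simp add: le_divide_eq)
        have "(real n / real R) ^ R \<le> real (n choose R)"
          by (rule binomial_ge_n_over_k_pow_k) fact
        also have "n choose R \<le> n choose r" using False rn by (intro binomial_mono) auto
        finally have "(real n / real R) ^ R \<le> V" by (simp add: V_def)
        then have "((real n / real R) ^ R) powr (\<theta> / 6) \<le> V powr (\<theta> / 6)"
          using \<theta> nR by (intro powr_mono2) auto
        also have "((real n / real R) ^ R) powr (\<theta> / 6) = (real n / real R) powr (real R * (\<theta> / 6))"
          using nR by (simp add: powr_powr flip: powr_realpow)
        finally have "(real n / real R) powr (real R * (\<theta> / 6)) \<le> V powr (\<theta> / 6)" .
        moreover have "(real n / real R) powr 9 \<le> (real n / real R) powr (real R * (\<theta> / 6))"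
          using R nR by (intro powr_mono) (auto simp: mult.commute)
        moreover have "(real n / real R) powr 9 = (real n / real R) ^ 9"
          using nR by simp
        \<comment> \<open>144 n^8 is 4 n, which bounds 4 ln V, times 36 n^7, the denominator of K
          for the circle method.\<close>
        moreover have "144 * real n ^ 8 \<le> (real n / real R) ^ 9"
        proof -
          have "144 * real n ^ 8 * real R ^ 9 = (144 * real R ^ 9) * real n ^ 8" by simp
          also have "\<dots> \<le> real n * real n ^ 8" using R9 by (intro mult_right_mono) auto
          also have "\<dots> = real n ^ 9" by (simp add: power_numeral_reduce)
          finally show ?thesis using R by (simp add: power_divide le_divide_eq)
        qed
        ultimately have big: "144 * real n ^ 8 \<le> V powr (\<theta> / 6)" by linarith
        have "V powr (- c) \<le> N powr (- c)" using c N1 NV by (intro powr_mono2') auto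
        then have pV: "V powr (- c) \<le> p" using pN by (simp add: N_def)
        have "V powr (\<theta> / 6) = V powr (- c + \<theta> / 3)" by (simp add: c_def)
        also have "\<dots> = V powr (- c) * V powr (\<theta> / 3)" by (rule powr_add)
        also have "\<dots> \<le> p * D" using pV D p by (intro mult_mono) auto
        finally have pD: "144 * real n ^ 8 \<le> p * D" using big by linarith
        have "n choose r \<le> 2 ^ n" by (rule binomial_le_pow2)
        then have "real (n choose r) \<le> real (2 ^ n)" by (rule of_nat_mono)
        then have "V \<le> 2 ^ n" by (simp add: V_def)
        then have "ln V \<le> ln (2 ^ n)" using V1 by (intro ln_mono) auto
        also have "\<dots> = real n * ln 2" by (simp add: ln_realpow)
        also have "\<dots> \<le> real n * 1" using ln_2_less_1 by (intro mult_left_mono) auto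
        finally have "4 * ln V * (36 * real n ^ 7) \<le> 4 * real n * (36 * real n ^ 7)"
          by (intro mult_right_mono) auto
        also have "\<dots> = 144 * real n ^ 8" by (simp add: power_numeral_reduce)
        also note pD
        finally have pK: "4 * ln V \<le> p * (D / (36 * real n ^ 7))" using n0 by (simp add: le_divide_eq)
        show ?thesis
          by (rule prob_EKR_ge[OF r(1) _ p pK[unfolded V_def D_def] _
                Kneser_supersaturation_large[OF r(1) rn]]) (use rn in auto)
      qed
    qed
  qed
  with c show ?thesis by (intro that[of c]) auto
qed

theorem theorem1p1:
  fixes \<epsilon> :: real
  assumes "\<epsilon> > 0"
  shows "(\<exists>c c' :: real. 0 < c \<and> c < c' \<and>
            (\<forall>(r :: nat \<Rightarrow> nat) (p :: nat \<Rightarrow> real).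
               (\<forall>\<^sub>F n in sequentially.
                  1 \<le> r n \<and> real (r n) \<le> (1/2 - \<epsilon>) * real n \<and> 0 \<le> p n \<and> p n \<le> 1 \<and>
                  p n \<ge> real ((n - 1) choose (r n - 1)) powr (- c))
               \<longrightarrow> (\<lambda>n. prob_EKR (p n) n (r n)) \<longlonglongrightarrow> 1) \<and>
            (\<forall>(r :: nat \<Rightarrow> nat) (p :: nat \<Rightarrow> real).
               (\<forall>\<^sub>F n in sequentially.
                  2 \<le> r n \<and> real (r n) \<le> (1/2 - \<epsilon>) * real n \<and> 0 \<le> p n \<and> p n \<le> 1 \<and>
                  p n \<le> real ((n - 1) choose (r n - 1)) powr (- c'))
               \<longrightarrow> (\<lambda>n. prob_EKR (p n) n (r n)) \<longlonglongrightarrow> 0))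
       \<and> (\<forall>r :: nat \<Rightarrow> nat.
            (\<forall>\<^sub>F n in sequentially. 2 \<le> r n \<and> real (r n) \<le> (1/2 - \<epsilon>) * real n)
            \<longrightarrow> (\<lambda>n. prob_EKR (1/2) n (r n)) \<longlonglongrightarrow> 1)"
proof -
  obtain c where c: "0 < c" "c < 1" and ev:
    "\<forall>\<^sub>F n in sequentially. \<forall>r p. 1 \<le> r \<longrightarrow> real r \<le> (1/2 - \<epsilon>) * real n \<longrightarrow> 0 \<le> p \<longrightarrow> p \<le> 1 \<longrightarrow>
       p \<ge> real ((n - 1) choose (r - 1)) powr (- c) \<longrightarrow> 1 - prob_EKR p n r \<le> 2 / real n"
    using prob_EKR_eventually_ge[OF assms] by blast
  have upper: "(\<lambda>n. prob_EKR (p n) n (r n)) \<longlonglongrightarrow> 1"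
    if h: "\<forall>\<^sub>F n in sequentially.
        1 \<le> r n \<and> real (r n) \<le> (1/2 - \<epsilon>) * real n \<and> 0 \<le> p n \<and> p n \<le> 1 \<and>
        p n \<ge> real ((n - 1) choose (r n - 1)) powr (- c)" for r :: "nat \<Rightarrow> nat" and p :: "nat \<Rightarrow> real"
  proof (rule tendsto_sandwich)
    show "\<forall>\<^sub>F n in sequentially. 1 - 2 / real n \<le> prob_EKR (p n) n (r n)"
      using ev h
    proof eventually_elim
      case (elim n)
      then have "1 - prob_EKR (p n) n (r n) \<le> 2 / real n" by blast
      then show ?case by linarith
    qed
    show "\<forall>\<^sub>F n in sequentially. prob_EKR (p n) n (r n) \<le> 1"
      by (simp add: prob_EKR_def)
    show "(\<lambda>n. 1 - 2 / real n) \<longlonglongrightarrow> 1" by real_asymp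
  qed simp
  have r_less: "r < n" if "1 \<le> r" "real r \<le> (1/2 - \<epsilon>) * real n" for r n :: nat
  proof -
    have "(1/2 - \<epsilon>) * real n \<le> (1/2) * real n" using assms by (intro mult_right_mono) auto
    then show ?thesis using that by linarith
  qed
  \<comment> \<open>With c' = 2 the bound p N becomes 1 / N, and r \<ge> 2 makes N at least n -
    1.\<close>
  have lower: "(\<lambda>n. prob_EKR (p n) n (r n)) \<longlonglongrightarrow> 0"
    if h: "\<forall>\<^sub>F n in sequentially.
        2 \<le> r n \<and> real (r n) \<le> (1/2 - \<epsilon>) * real n \<and> 0 \<le> p n \<and> p n \<le> 1 \<and>
        p n \<le> real ((n - 1) choose (r n - 1)) powr (- 2)" for r :: "nat \<Rightarrow> nat" and p :: "nat \<Rightarrow> real"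
  proof (rule tendsto_sandwich)
    show "\<forall>\<^sub>F n in sequentially. prob_EKR (p n) n (r n) \<le> 1 / (real n - 1)"
      using h
    proof eventually_elim
      case (elim n)
      define N where "N = real ((n - 1) choose (r n - 1))"
      have r: "1 \<le> r n" "r n < n" using elim r_less[of "r n" n] by auto
      have "real (n - 1) \<le> N" unfolding N_def
        using choose_pred_ge[of "r n" n] elim r by (intro of_nat_mono) auto
      then have Nn: "real n - 1 \<le> N" using r by (simp add: of_nat_diff)
      have n1: "real n - 1 > 0" using r elim by linarith
      have "prob_EKR (p n) n (r n) \<le> p n * N"
        using prob_EKR_le[OF r] elim by (simp add: N_def)
      also have "\<dots> \<le> N powr (- 2) * N"
        using elim Nn n1 by (intro mult_right_mono) (auto simp: N_def)
      also have "\<dots> = 1 / N"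
        using Nn n1 by (simp add: powr_minus field_simps power2_eq_square)
      also have "\<dots> \<le> 1 / (real n - 1)" using Nn n1 by (intro divide_left_mono) auto
      finally show ?case .
    qed
    show "\<forall>\<^sub>F n in sequentially. 0 \<le> prob_EKR (p n) n (r n)"
      by (simp add: prob_EKR_def)
    show "(\<lambda>n. 1 / (real n - 1)) \<longlonglongrightarrow> 0" by real_asymp
  qed simp
  have half: "(\<lambda>n. prob_EKR (1/2) n (r n)) \<longlonglongrightarrow> 1"
    if h: "\<forall>\<^sub>F n in sequentially. 2 \<le> r n \<and> real (r n) \<le> (1/2 - \<epsilon>) * real n" for r :: "nat \<Rightarrow> nat"
  proof (rule upper)
    \<comment> \<open>N \<ge> n - 1 brings the threshold below 1/2 eventually, whatever the sequence
      r, so p = 1/2 falls into the upper range.\<close>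
    have "\<forall>\<^sub>F n in sequentially. (real n - 1) powr (- c) \<le> 1/2" using c by real_asymp
    with h show "\<forall>\<^sub>F n in sequentially. 1 \<le> r n \<and> real (r n) \<le> (1/2 - \<epsilon>) * real n \<and>
        0 \<le> (1/2::real) \<and> (1/2::real) \<le> 1 \<and> real ((n - 1) choose (r n - 1)) powr (- c) \<le> 1/2"
    proof eventually_elim
      case (elim n)
      have r: "1 \<le> r n" "r n < n" using elim r_less[of "r n" n] by auto
      have "real (n - 1) \<le> real ((n - 1) choose (r n - 1))"
        using choose_pred_ge[of "r n" n] elim r by (intro of_nat_mono) auto
      then have Nn: "real n - 1 \<le> real ((n - 1) choose (r n - 1))" using r by (simp add: of_nat_diff)
      have n1: "real n - 1 > 0" using r elim by linarith
      have "real ((n - 1) choose (r n - 1)) powr (- c) \<le> (real n - 1) powr (- c)"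
        using c Nn n1 by (intro powr_mono2') auto
      then show ?case using elim by auto
    qed
  qed
  show ?thesis
    using c upper lower half by (intro conjI exI[of _ c] exI[of _ "2::real"] allI impI) auto
qed

end
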